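(* Let $G$ be an amenable group, $A$ an abelian group, and $G\overset{\alpha}{\curvearrowright}A$ a left action by group endomorphisms. If $N$ is a normal subgroup of $G$, then $$h_{alg}(\alpha)\le h_{alg}(\alpha\restriction_N)\quad\text{and}\quad \mathrm{ent}(\alpha)\le\mathrm{ent}(\alpha\restriction_N).$$
   Context: Groups are considered as discrete groups; amenability is the usual notion. A right Følner net of an amenable group $G$ is a net $(F_i)_{i\in I}$ of non-empty finite subsets of $G$ with $\lim_{i\in I}|F_ig\setminus F_i|/|F_i|=0$ for every $g\in G$. A left action $G\overset{\alpha}{\curvearrowright}A$ on an abelian group $A$ assigns to each $g\in G$ an endomorphism $\alpha(g)$ of $A$ with $\alpha(gh)=\alpha(g)\circ\alpha(h)$ and $\alpha(1)=\mathrm{id}_A$. For a subgroup $N\le G$, $\alpha\restriction_N$ is the restricted action of $N$ on $A$ (its entropy is computed with Følner nets of $N$). For non-empty finite $X\subseteq A$ and non-empty finite $F\subseteq G$ put $T_F(\alpha,X)=\sum_{g\in F}\alpha(g)(X)$ (sum of subsets). Set $H_{alg}(\alpha,X)=\lim_{i\in I}\frac{\log|T_{F_i}(\alpha,X)|}{|F_i|}$ for any right Følner net $(F_i)_{i\in I}$ of $G$; the limit is known to exist, to be finite, and not to depend on the net. Define $h_{alg}(\alpha)=\sup\{H_{alg}(\alpha,X):X\subseteq A\text{ non-empty finite}\}$ and $\mathrm{ent}(\alpha)=\sup\{H_{alg}(\alpha,X):X\text{ a finite subgroup of }A\}$, both in $[0,\infty]$. *)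

theory Defs
  imports "HOL-Algebra.Coset" "HOL-Algebra.FiniteProduct" "HOL-Library.Extended_Real"
begin

section \<open>Amenability\<close>

text \<open>Amenability of a discrete group in the sense of von Neumann: there is a left invariant, finitely
  additive probability measure defined on all subsets.\<close>

definition amenable :: "('g, 'm) monoid_scheme \<Rightarrow> bool" where
  "amenable G \<longleftrightarrow>
    (\<exists>\<mu> :: 'g set \<Rightarrow> real.
       (\<forall>E. E \<subseteq> carrier G \<longrightarrow> 0 \<le> \<mu> E) \<and>
       \<mu> (carrier G) = 1 \<and>
       (\<forall>E E'. E \<subseteq> carrier G \<longrightarrow> E' \<subseteq> carrier G \<longrightarrow> E \<inter> E' = {} \<longrightarrow> \<mu> (E \<union> E') = \<mu> E + \<mu> E') \<and>
       (\<forall>g \<in> carrier G. \<forall>E. E \<subseteq> carrier G \<longrightarrow> \<mu> (g <#\<^bsub>G\<^esub> E) = \<mu> E))"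


section \<open>Nets and right Folner nets\<close>

definition directed_index :: "'i set \<Rightarrow> ('i \<Rightarrow> 'i \<Rightarrow> bool) \<Rightarrow> bool" where
  "directed_index I r \<longleftrightarrow>
     I \<noteq> {} \<and> reflp_on I r \<and> transp_on I r \<and> (\<forall>i\<in>I. \<forall>j\<in>I. \<exists>k\<in>I. r i k \<and> r j k)"

definition net_filter :: "'i set \<Rightarrow> ('i \<Rightarrow> 'i \<Rightarrow> bool) \<Rightarrow> 'i filter" where
  "net_filter I r = (INF i\<in>I. principal {j\<in>I. r i j})"

lemma eventually_net_filter:
  assumes "directed_index I r"
  shows "eventually P (net_filter I r) \<longleftrightarrow> (\<exists>i\<in>I. \<forall>j\<in>I. r i j \<longrightarrow> P j)"
proof -
  have "eventually P (net_filter I r) \<longleftrightarrow> (\<exists>i\<in>I. eventually P (principal {j\<in>I. r i j}))"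
    unfolding net_filter_def
  proof (rule eventually_INF_base)
    show "I \<noteq> {}" using assms by (simp add: directed_index_def)
  next
    fix a b assume ab: "a \<in> I" "b \<in> I"
    then obtain k where k: "k \<in> I" "r a k" "r b k"
      using assms unfolding directed_index_def by blast
    have "transp_on I r" using assms by (simp add: directed_index_def)
    then have "{j\<in>I. r k j} \<subseteq> {j\<in>I. r a j} \<inter> {j\<in>I. r b j}"
      using ab k by (auto dest: transp_onD)
    then show "\<exists>x\<in>I. principal {j \<in> I. r x j}
        \<le> inf (principal {j \<in> I. r a j}) (principal {j \<in> I. r b j})"
      using k(1) by (auto intro!: bexI[of _ k])
  qed
  then show ?thesis by (auto simp: eventually_principal)
qed

definition right_folner_net ::
    "('g, 'm) monoid_scheme \<Rightarrow> 'i set \<Rightarrow> ('i \<Rightarrow> 'i \<Rightarrow> bool) \<Rightarrow> ('i \<Rightarrow> 'g set) \<Rightarrow> bool" where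
  "right_folner_net G I r F \<longleftrightarrow>
     directed_index I r \<and>
     (\<forall>i\<in>I. finite (F i) \<and> F i \<noteq> {} \<and> F i \<subseteq> carrier G) \<and>
     (\<forall>g\<in>carrier G.
        ((\<lambda>i. real (card ((F i #>\<^bsub>G\<^esub> g) - F i)) / real (card (F i))) \<longlongrightarrow> 0) (net_filter I r))"


section \<open>Actions by endomorphisms and their algebraic entropies\<close>

text \<open>The abelian group \<open>A\<close> is written multiplicatively, as is usual for \<^locale>\<open>comm_group\<close>; thus
  sums in \<open>A\<close> appear as \<^const>\<open>finprod\<close>.\<close>

definition endo_action ::
    "('g, 'm) monoid_scheme \<Rightarrow> ('a, 'n) monoid_scheme \<Rightarrow> ('g \<Rightarrow> 'a \<Rightarrow> 'a) \<Rightarrow> bool" where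
  "endo_action G A \<alpha> \<longleftrightarrow>
     (\<forall>g\<in>carrier G. \<alpha> g \<in> hom A A) \<and>
     (\<forall>g\<in>carrier G. \<forall>h\<in>carrier G. \<forall>a\<in>carrier A. \<alpha> (g \<otimes>\<^bsub>G\<^esub> h) a = \<alpha> g (\<alpha> h a)) \<and>
     (\<forall>a\<in>carrier A. \<alpha> \<one>\<^bsub>G\<^esub> a = a)"

definition trajectory ::
    "('a, 'n) monoid_scheme \<Rightarrow> ('g \<Rightarrow> 'a \<Rightarrow> 'a) \<Rightarrow> 'g set \<Rightarrow> 'a set \<Rightarrow> 'a set" where
  "trajectory A \<alpha> F X = {\<Otimes>\<^bsub>A\<^esub>g\<in>F. x g | x. \<forall>g\<in>F. x g \<in> \<alpha> g ` X}"

text \<open>The common limit along all right Folner nets. HOL cannot quantify over index types here, so the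
  nets are indexed by subsets of \<open>'g set \<times> nat\<close>, under arbitrary directed preorders; by lemma
  \<open>folner_limit_any_index\<close> below, the limit along these is the limit along right Folner nets with any
  index type. Nets that exhaust the pairs (finite subset of \<open>G\<close>, positive precision) have such indices,
  so every amenable group has a right Folner net of this kind.\<close>

definition H_alg ::
    "('g, 'm) monoid_scheme \<Rightarrow> ('a, 'n) monoid_scheme \<Rightarrow> ('g \<Rightarrow> 'a \<Rightarrow> 'a) \<Rightarrow> 'a set \<Rightarrow> real" where
  "H_alg G A \<alpha> X =
     (THE L. \<forall>(I :: ('g set \<times> nat) set) r F. right_folner_net G I r F \<longrightarrow>
        ((\<lambda>i. ln (real (card (trajectory A \<alpha> (F i) X))) / real (card (F i))) \<longlongrightarrow> L)
          (net_filter I r))"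

definition h_alg ::
    "('g, 'm) monoid_scheme \<Rightarrow> ('a, 'n) monoid_scheme \<Rightarrow> ('g \<Rightarrow> 'a \<Rightarrow> 'a) \<Rightarrow> ereal" where
  "h_alg G A \<alpha> = (SUP X \<in> {X. X \<subseteq> carrier A \<and> finite X \<and> X \<noteq> {}}. ereal (H_alg G A \<alpha> X))"

definition ent ::
    "('g, 'm) monoid_scheme \<Rightarrow> ('a, 'n) monoid_scheme \<Rightarrow> ('g \<Rightarrow> 'a \<Rightarrow> 'a) \<Rightarrow> ereal" where
  "ent G A \<alpha> = (SUP X \<in> {X. subgroup X A \<and> finite X}. ereal (H_alg G A \<alpha> X))"

lemma folner_limit_any_index:
  fixes G :: "('g, 'm) monoid_scheme" and \<phi> :: "'g set \<Rightarrow> real"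
    and J :: "'j set"
  assumes lim: "\<And>(I :: ('g set \<times> nat) set) r F. right_folner_net G I r F \<Longrightarrow>
      ((\<lambda>i. \<phi> (F i)) \<longlongrightarrow> L) (net_filter I r)"
    and E: "right_folner_net G J r' E"
  shows "((\<lambda>j. \<phi> (E j)) \<longlongrightarrow> L) (net_filter J r')"
proof (rule ccontr)
  assume "\<not> ?thesis"
  then obtain e where e: "e > 0"
    and ne: "\<not> eventually (\<lambda>j. dist (\<phi> (E j)) L < e) (net_filter J r')"
    unfolding tendsto_iff by blast
  have dJ: "directed_index J r'" using E by (simp add: right_folner_net_def)
  define q where "q = (\<lambda>S g. real (card ((S #>\<^bsub>G\<^esub> g) - S)) / real (card S))"
  define I where "I = {(K, n :: nat). finite K \<and> K \<subseteq> carrier G}"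
  define r where "r = (\<lambda>(K, n :: nat) (K' :: 'g set, n'). K \<subseteq> K' \<and> n \<le> n')"
  have ex: "\<exists>j\<in>J. (\<forall>g\<in>fst p. q (E j) g < 1 / real (Suc (snd p))) \<and> \<not> dist (\<phi> (E j)) L < e"
    if p: "p \<in> I" for p
  proof -
    have "\<forall>\<^sub>F j in net_filter J r'. q (E j) g < 1 / real (Suc (snd p))" if "g \<in> fst p" for g
    proof -
      have "g \<in> carrier G" using p that by (auto simp: I_def)
      then have "((\<lambda>j. q (E j) g) \<longlongrightarrow> 0) (net_filter J r')"
        using E by (auto simp: right_folner_net_def q_def)
      then show ?thesis by (rule order_tendstoD) auto
    qed
    then have "\<forall>\<^sub>F j in net_filter J r'. \<forall>g\<in>fst p. q (E j) g < 1 / real (Suc (snd p))"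
      using p by (intro eventually_ball_finite) (auto simp: I_def)
    then show ?thesis
      using ne unfolding eventually_net_filter[OF dJ] by blast
  qed
  define j where "j = (\<lambda>p. SOME j. j \<in> J \<and>
     (\<forall>g\<in>fst p. q (E j) g < 1 / real (Suc (snd p))) \<and> \<not> dist (\<phi> (E j)) L < e)"
  have j: "j p \<in> J \<and> (\<forall>g\<in>fst p. q (E (j p)) g < 1 / real (Suc (snd p))) \<and>
      \<not> dist (\<phi> (E (j p))) L < e" if "p \<in> I" for p
    unfolding j_def by (rule someI_ex) (use ex[OF that] in blast)
  have dI: "directed_index I r"
    unfolding directed_index_def
  proof (intro conjI ballI)
    show "I \<noteq> {}" by (auto simp: I_def)
    show "reflp_on I r" by (auto simp: r_def reflp_on_def)
    show "transp_on I r" by (auto simp: r_def transp_on_def)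
    fix a b assume "a \<in> I" "b \<in> I"
    then show "\<exists>k\<in>I. r a k \<and> r b k"
      by (intro bexI[of _ "(fst a \<union> fst b, max (snd a) (snd b))"]) (auto simp: I_def r_def)
  qed
  have "right_folner_net G I r (\<lambda>p. E (j p))"
    unfolding right_folner_net_def
  proof (intro conjI ballI)
    fix p assume "p \<in> I"
    then have "j p \<in> J" using j by blast
    then show "finite (E (j p))" "E (j p) \<noteq> {}" "E (j p) \<subseteq> carrier G"
      using E by (auto simp: right_folner_net_def)
  next
    fix g assume g: "g \<in> carrier G"
    have "((\<lambda>p. q (E (j p)) g) \<longlongrightarrow> 0) (net_filter I r)"
    proof (rule tendstoI)
      fix d :: real assume "d > 0"
      then obtain n where n: "1 / real (Suc n) < d"
        using nat_approx_posE by blast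
      have "dist (q (E (j p)) g) 0 < d" if p: "p \<in> I" "r ({g}, n) p" for p
      proof -
        have "q (E (j p)) g < 1 / real (Suc (snd p))"
          using j[OF p(1)] p(2) by (auto simp: r_def split: prod.splits)
        also have "\<dots> \<le> 1 / real (Suc n)"
          using p(2) by (intro divide_left_mono) (auto simp: r_def split: prod.splits)
        finally have "q (E (j p)) g < d" using n by simp
        moreover have "0 \<le> q (E (j p)) g" by (simp add: q_def)
        ultimately show ?thesis by simp
      qed
      moreover have "({g}, n) \<in> I" using g by (simp add: I_def)
      ultimately show "\<forall>\<^sub>F p in net_filter I r. dist (q (E (j p)) g) 0 < d"
        unfolding eventually_net_filter[OF dI] by blast
    qed
    then show "((\<lambda>p. real (card ((E (j p) #>\<^bsub>G\<^esub> g) - E (j p))) / real (card (E (j p)))) \<longlongrightarrow> 0)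
        (net_filter I r)"
      by (simp add: q_def)
  qed (use dI in auto)
  from lim[OF this] e have "\<forall>\<^sub>F p in net_filter I r. dist (\<phi> (E (j p))) L < e"
    by (simp add: tendsto_iff)
  then obtain p where "p \<in> I" "\<forall>p'\<in>I. r p p' \<longrightarrow> dist (\<phi> (E (j p'))) L < e"
    unfolding eventually_net_filter[OF dI] by blast
  moreover have "r p p" by (simp add: r_def split: prod.splits)
  ultimately show False using j by blast
qed

end

theory Submission
  imports Defs "HOL-Analysis.Convex" "HOL-Library.Nat_Bijection"
begin

text \<open>Write \<open>u(K) = log |T\<^sub>K(\<alpha>, X)| / |K|\<close>. Shearer's inequality for sumsets, applied to the translates
  \<open>c K\<close> that cover a finite set \<open>F\<close> exactly \<open>|K|\<close> times, gives
  \<open>u(F) \<le> (|F K\<^sup>-\<^sup>1| / |F|) u(K)\<close>. Along a right Folner net the factor tends to 1, so the limit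
  \<open>H_alg(\<alpha>, X)\<close> exists and equals the infimum of \<open>u(K)\<close> over all non-empty finite \<open>K \<subseteq> G\<close>. For the
  restricted action the infimum is over the smaller family of \<open>K \<subseteq> N\<close>. That \<open>H_alg\<close> is well defined
  also needs Folner nets of \<open>G\<close> and \<open>N\<close>, which are derived from the invariant mean by Hall's theorem.\<close>

text \<open>Mere subadditivity of \<open>log |T_F|\<close> would not bound the limit by the quotient
  of an arbitrary finite \<open>K\<close>, since translates of \<open>K\<close> need not tile the
  group. The exact multiple covering replaces a tiling, and Shearer's inequality is what permits
  dividing by the multiplicity. It speaks of tuples, whereas a sum does not determine its summands;
  hence the choice of canonical representatives. The sides are forced: as \<alpha> is a left action,
  \<alpha>(c) maps T_K onto T_{cK}, so left translates of \<open>K\<close> do not increase the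
  count, and the elements \<open>c\<close> that occur fill F K^-1, whose size right Folner sets
  control. The mean in \<open>amenable\<close> is left invariant and has to be carried through
  inversion to fit. Existence of nets matters because without any net every real would satisfy the
  condition under \<open>THE\<close>.\<close>

section \<open>Hall's theorem and Folner nets\<close>

text \<open>Rado's argument: a minimal set of edges satisfying Hall's condition leaves one edge per index.\<close>

lemma infinite_Hall:
  fixes A :: "'i \<Rightarrow> 'x set"
  assumes fin: "\<And>i. i \<in> I \<Longrightarrow> finite (A i)"
    and hall: "\<And>J. finite J \<Longrightarrow> J \<subseteq> I \<Longrightarrow> card J \<le> card (\<Union>i\<in>J. A i)"
  shows "\<exists>f. inj_on f I \<and> (\<forall>i\<in>I. f i \<in> A i)"
proof -
  \<comment> \<open>\<open>D\<close> collects deleted edges and \<open>B D i\<close> is what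
    survives at \<open>i\<close>, so a maximal member of \<open>\<D>\<close> is a minimal graph with
    Hall's condition.\<close>
  define B where "B = (\<lambda>D i. {x \<in> A i. (i, x) \<notin> D})"
  define \<D> where "\<D> = {D. \<forall>J. finite J \<longrightarrow> J \<subseteq> I \<longrightarrow> card J \<le> card (\<Union>i\<in>J. B D i)}"
  have finB: "finite (B D i)" if "i \<in> I" for D i
    using fin[OF that] by (simp add: B_def)
  have "\<exists>M\<in>\<D>. \<forall>D\<in>\<D>. M \<subseteq> D \<longrightarrow> D = M"
  proof (rule subset_Zorn_nonempty)
    have "{} \<in> \<D>" using hall by (simp add: \<D>_def B_def)
    then show "\<D> \<noteq> {}" by blast
  next
    fix \<C> assume ne: "\<C> \<noteq> {}" and ch: "subset.chain \<D> \<C>"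
    have "card J \<le> card (\<Union>i\<in>J. B (\<Union>\<C>) i)" if J: "finite J" "J \<subseteq> I" for J
    proof -
      \<comment> \<open>Finiteness of the sets \<open>A i\<close> enters here: only finitely many
        edges start in \<open>J\<close>, so one member of the chain already deletes all that the
        union deletes there.\<close>
      have "finite (Sigma J A \<inter> \<Union>\<C>)" using J fin by blast
      then obtain D where D: "D \<in> \<C>" "Sigma J A \<inter> \<Union>\<C> \<subseteq> D"
        using finite_subset_Union_chain[OF _ _ ne ch] by (metis Int_lower2)
      have "B (\<Union>\<C>) i = B D i" if "i \<in> J" for i
        using D that unfolding B_def by blast
      moreover have "D \<in> \<D>" using D ch by (auto simp: subset_chain_def)
      ultimately show ?thesis using J by (simp add: \<D>_def)
    qed
    then show "\<Union>\<C> \<in> \<D>" by (simp add: \<D>_def)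
  qed
  then obtain D where D: "D \<in> \<D>" and max: "\<And>D'. D' \<in> \<D> \<Longrightarrow> D \<subseteq> D' \<Longrightarrow> D' = D"
    by blast
  have hallD: "card J \<le> card (\<Union>i\<in>J. B D i)" if "finite J" "J \<subseteq> I" for J
    using D that by (simp add: \<D>_def)
  \<comment> \<open>By maximality, deleting the edge \<open>(i, x)\<close> breaks Hall's condition,
    and only on a set containing \<open>i\<close>. The \<open>J\<close> given here is that set
    without \<open>i\<close>, which turns the strict inequality into \<le>.\<close>
  have crit: "\<exists>J. finite J \<and> J \<subseteq> I \<and> i \<notin> J \<and> card ((\<Union>j\<in>J. B D j) \<union> (B D i - {x})) \<le> card J"
    if i: "i \<in> I" and x: "x \<in> B D i" for i x
  proof -
    have "(i, x) \<notin> D" using x by (simp add: B_def)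
    then have "insert (i, x) D \<notin> \<D>" using max[of "insert (i, x) D"] by blast
    then obtain J where J: "finite J" "J \<subseteq> I" and lt: "card (\<Union>j\<in>J. B (insert (i, x) D) j) < card J"
      unfolding \<D>_def by (auto simp: not_le)
    have other: "B (insert (i, x) D) j = B D j" if "j \<noteq> i" for j using that by (auto simp: B_def)
    have at_i: "B (insert (i, x) D) i = B D i - {x}" by (auto simp: B_def)
    have iJ: "i \<in> J"
    proof (rule ccontr)
      assume "i \<notin> J"
      then have "(\<Union>j\<in>J. B (insert (i, x) D) j) = (\<Union>j\<in>J. B D j)"
        by (intro SUP_cong refl other) auto
      then show False using lt hallD[OF J] by simp
    qed
    have "(\<Union>j\<in>J. B (insert (i, x) D) j) = (\<Union>j\<in>J - {i}. B D j) \<union> (B D i - {x})"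
    proof -
      have "(\<Union>j\<in>J. B (insert (i, x) D) j) =
          B (insert (i, x) D) i \<union> (\<Union>j\<in>J - {i}. B (insert (i, x) D) j)"
        using iJ by blast
      also have "(\<Union>j\<in>J - {i}. B (insert (i, x) D) j) = (\<Union>j\<in>J - {i}. B D j)"
        by (intro SUP_cong refl other) auto
      finally show ?thesis using at_i by (simp add: Un_commute)
    qed
    then show ?thesis
      using lt J iJ by (intro exI[of _ "J - {i}"]) (simp add: subset_iff)
  qed
  \<comment> \<open>As \<open>x\<close> and \<open>y\<close> differ, \<open>?P\<close> and
    \<open>?Q\<close> together recover all of \<open>B D i\<close>. Hall's condition for the union
    with \<open>i\<close> and for the intersection then demands one element more than the two
    critical sets supply.\<close>
  have single: "x = y" if i: "i \<in> I" and xy: "x \<in> B D i" "y \<in> B D i" for i x y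
  proof (rule ccontr)
    assume "x \<noteq> y"
    let ?B = "\<lambda>J. \<Union>j\<in>J. B D j"
    obtain J where J: "finite J" "J \<subseteq> I" "i \<notin> J" and cJ: "card (?B J \<union> (B D i - {x})) \<le> card J"
      using crit[OF i xy(1)] by blast
    obtain L where L: "finite L" "L \<subseteq> I" "i \<notin> L" and cL: "card (?B L \<union> (B D i - {y})) \<le> card L"
      using crit[OF i xy(2)] by blast
    let ?P = "?B J \<union> (B D i - {x})" and ?Q = "?B L \<union> (B D i - {y})"
    have finP: "finite ?P" "finite ?Q" using J L finB i by auto
    have "card J + card L + 1 = card (insert i (J \<union> L)) + card (J \<inter> L)"
      using card_Un_Int[OF J(1) L(1)] J L by simp
    also have "\<dots> \<le> card (?B (insert i (J \<union> L))) + card (?B (J \<inter> L))"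
      using J L i by (intro add_mono hallD) auto
    also have "?B (insert i (J \<union> L)) = ?P \<union> ?Q"
      using \<open>x \<noteq> y\<close> by auto
    also have "card (?B (J \<inter> L)) \<le> card (?P \<inter> ?Q)"
      using finP by (intro card_mono finite_Int disjI1) blast+
    also have "card (?P \<union> ?Q) + card (?P \<inter> ?Q) = card ?P + card ?Q"
      using card_Un_Int[OF finP] by simp
    finally show False using cJ cL by simp
  qed
  define f where "f = (\<lambda>i. SOME x. x \<in> B D i)"
  have f: "f i \<in> B D i" if "i \<in> I" for i
  proof -
    have "B D i \<noteq> {}" using hallD[of "{i}"] that by auto
    then show ?thesis unfolding f_def by (simp add: some_in_eq)
  qed
  have "inj_on f I"
  proof (rule inj_onI, rule ccontr)
    fix i j assume ij: "i \<in> I" "j \<in> I" "f i = f j" "i \<noteq> j"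
    have "(\<Union>k\<in>{i, j}. B D k) \<subseteq> {f i}" using single f ij by auto
    then have "card (\<Union>k\<in>{i, j}. B D k) \<le> 1" using card_mono[of "{f i}"] by simp
    then show False using hallD[of "{i, j}"] ij by simp
  qed
  then show ?thesis using f by (auto simp: B_def)
qed

section \<open>From invariant means to Folner sets\<close>

lemma finite_additivity:
  fixes \<mu> :: "'g set \<Rightarrow> real"
  assumes add: "\<And>E E'. E \<subseteq> X \<Longrightarrow> E' \<subseteq> X \<Longrightarrow> E \<inter> E' = {} \<Longrightarrow> \<mu> (E \<union> E') = \<mu> E + \<mu> E'"
    and "finite I" "\<And>i. i \<in> I \<Longrightarrow> D i \<subseteq> X"
    and "\<And>i j. i \<in> I \<Longrightarrow> j \<in> I \<Longrightarrow> i \<noteq> j \<Longrightarrow> D i \<inter> D j = {}"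
  shows "\<mu> (\<Union>i\<in>I. D i) = (\<Sum>i\<in>I. \<mu> (D i))"
  using assms(2-)
proof (induction I rule: finite_induct)
  case empty
  show ?case using add[of "{}" "{}"] by simp
next
  case (insert i I)
  have "\<mu> (D i \<union> (\<Union>j\<in>I. D j)) = \<mu> (D i) + \<mu> (\<Union>j\<in>I. D j)"
  proof (rule add)
    show "D i \<inter> (\<Union>j\<in>I. D j) = {}"
      using insert.prems(2)[of i] insert.hyps(2) by (fastforce simp: disjoint_iff)
  qed (use insert.prems(1) in auto)
  moreover have "\<mu> (\<Union>j\<in>I. D j) = (\<Sum>j\<in>I. \<mu> (D j))"
    using insert.prems by (intro insert.IH) auto
  ultimately show ?case using insert.hyps by simp
qed

lemma amenableE:
  fixes G (structure)
  assumes "amenable G"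
  obtains \<mu> :: "'a set \<Rightarrow> real" where "\<And>E. E \<subseteq> carrier G \<Longrightarrow> 0 \<le> \<mu> E" "\<mu> (carrier G) = 1"
    "\<And>E E'. E \<subseteq> carrier G \<Longrightarrow> E' \<subseteq> carrier G \<Longrightarrow> E \<inter> E' = {} \<Longrightarrow> \<mu> (E \<union> E') = \<mu> E + \<mu> E'"
    "\<And>g E. g \<in> carrier G \<Longrightarrow> E \<subseteq> carrier G \<Longrightarrow> \<mu> (g <# E) = \<mu> E"
proof -
  from assms[unfolded amenable_def] show thesis
  proof (elim exE conjE)
    fix \<mu> :: "'a set \<Rightarrow> real"
    assume *: "\<forall>E. E \<subseteq> carrier G \<longrightarrow> 0 \<le> \<mu> E" "\<mu> (carrier G) = 1"
      "\<forall>E E'. E \<subseteq> carrier G \<longrightarrow> E' \<subseteq> carrier G \<longrightarrow> E \<inter> E' = {} \<longrightarrow> \<mu> (E \<union> E') = \<mu> E + \<mu> E'"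
      "\<forall>g\<in>carrier G. \<forall>E. E \<subseteq> carrier G \<longrightarrow> \<mu> (g <# E) = \<mu> E"
    show thesis by (rule that[of \<mu>]) (rule *(1)[rule_format] *(2) *(3)[rule_format] *(4)[rule_format]; assumption)+
  qed
qed

text \<open>Inversion exchanges left and right multiplication, so \<mu>(E^-1) is right invariant in
  \<open>E\<close>. This form is needed where points are moved by right factors from a finite
  set.\<close>

lemma (in group) amenable_right_invariant:
  assumes "amenable G"
  obtains \<nu> :: "'a set \<Rightarrow> real" where "\<And>E. E \<subseteq> carrier G \<Longrightarrow> 0 \<le> \<nu> E" "\<nu> (carrier G) = 1"
    "\<And>E E'. E \<subseteq> carrier G \<Longrightarrow> E' \<subseteq> carrier G \<Longrightarrow> E \<inter> E' = {} \<Longrightarrow> \<nu> (E \<union> E') = \<nu> E + \<nu> E'"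
    "\<And>g E. g \<in> carrier G \<Longrightarrow> E \<subseteq> carrier G \<Longrightarrow> \<nu> (E #> g) = \<nu> E"
proof -
  obtain \<mu> :: "'a set \<Rightarrow> real" where
    pos: "\<And>E. E \<subseteq> carrier G \<Longrightarrow> 0 \<le> \<mu> E" and one: "\<mu> (carrier G) = 1"
    and add: "\<And>E E'. E \<subseteq> carrier G \<Longrightarrow> E' \<subseteq> carrier G \<Longrightarrow> E \<inter> E' = {} \<Longrightarrow> \<mu> (E \<union> E') = \<mu> E + \<mu> E'"
    and inv: "\<And>g E. g \<in> carrier G \<Longrightarrow> E \<subseteq> carrier G \<Longrightarrow> \<mu> (g <# E) = \<mu> E"
    by (fact amenableE[OF assms])
  have sub: "m_inv G ` E \<subseteq> carrier G" if "E \<subseteq> carrier G" for E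
    using that by auto
  show thesis
  proof (rule that[of "\<lambda>E. \<mu> (m_inv G ` E)"])
    fix E assume "E \<subseteq> carrier G"
    then show "0 \<le> \<mu> (m_inv G ` E)" using pos sub by blast
  next
    have "m_inv G ` carrier G = carrier G"
      by (auto intro!: image_eqI[of _ _ "inv _"])
    then show "\<mu> (m_inv G ` carrier G) = 1" using one by simp
  next
    fix E E' assume E: "E \<subseteq> carrier G" "E' \<subseteq> carrier G" "E \<inter> E' = {}"
    have "m_inv G ` E \<inter> m_inv G ` E' = m_inv G ` (E \<inter> E')"
      by (rule inj_on_image_Int[OF inv_inj, symmetric]) (use E in auto)
    then show "\<mu> (m_inv G ` (E \<union> E')) = \<mu> (m_inv G ` E) + \<mu> (m_inv G ` E')"
      using E add sub by (simp add: image_Un)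
  next
    fix g E assume g: "g \<in> carrier G" "E \<subseteq> carrier G"
    then have "inv (x \<otimes> g) = inv g \<otimes> inv x" if "x \<in> E" for x
      using that by (intro inv_mult_group) auto
    then have "m_inv G ` (E #> g) = inv g <# (m_inv G ` E)"
      by (simp add: r_coset_def l_coset_def image_UN)
    then show "\<mu> (m_inv G ` (E #> g)) = \<mu> (m_inv G ` E)"
      using g inv sub by simp
  qed
qed

text \<open>Otherwise finite sets expand by a factor 2 under multiplication by some finite \<open>M\<close>, and Hall's
  theorem yields a 2-to-1 piecewise right translation of \<open>G\<close> into itself, against the mean.\<close>

lemma (in group) amenable_folner_set:
  assumes am: "amenable G" and K: "finite K" "K \<subseteq> carrier G" and e: "e > 0"
  shows "\<exists>F. finite F \<and> F \<noteq> {} \<and> F \<subseteq> carrier G \<and>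
    (\<forall>g\<in>K. real (card ((F #> g) - F)) < e * real (card F))"
proof (rule ccontr)
  assume "\<not> ?thesis"
  then have no: "\<exists>g\<in>K. e * real (card F) \<le> real (card ((F #> g) - F))"
    if "finite F" "F \<noteq> {}" "F \<subseteq> carrier G" for F
    using that by (auto simp: not_less)
  define L where "L = insert \<one> K"
  have L: "finite L" "L \<subseteq> carrier G" using K by (auto simp: L_def)
  have fin_mult: "finite (S <#> T)" if "finite S" "finite T" for S T
    using that by (simp add: set_mult_def)
  have expand: "(1 + e) * real (card F) \<le> real (card (F <#> L))"
    if F: "finite F" "F \<subseteq> carrier G" for F
  proof (cases "F = {}")
    case False
    then obtain g where g: "g \<in> K" "e * real (card F) \<le> real (card ((F #> g) - F))"
      using no F by blast
    have "F \<subseteq> F <#> L"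
    proof
      fix x assume "x \<in> F"
      then have "x = x \<otimes> \<one>" using F by auto
      then show "x \<in> F <#> L" using \<open>x \<in> F\<close> by (force simp: set_mult_def L_def)
    qed
    moreover have "F #> g \<subseteq> F <#> L" using g(1) by (auto simp: r_coset_def set_mult_def L_def)
    ultimately have "card (F \<union> ((F #> g) - F)) \<le> card (F <#> L)"
      by (intro card_mono fin_mult F L) auto
    moreover have "card (F \<union> ((F #> g) - F)) = card F + card ((F #> g) - F)"
      using F by (intro card_Un_disjoint) (auto simp: r_coset_def)
    ultimately show ?thesis using g(2) by (simp add: algebra_simps)
  qed simp
  \<comment> \<open>Iterating the expansion by \<open>L\<close> raises the factor to any power, with
    a finite multiplier \<open>M\<close> that does not depend on \<open>F\<close>.\<close>
  have pow: "\<exists>M. finite M \<and> M \<subseteq> carrier G \<and>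
      (\<forall>F. finite F \<longrightarrow> F \<subseteq> carrier G \<longrightarrow> (1 + e) ^ n * real (card F) \<le> real (card (F <#> M)))" for n
  proof (induction n)
    case 0
    have "F <#> {\<one>} = F" if "F \<subseteq> carrier G" for F
      using coset_mult_one[OF that] by (simp add: r_coset_eq_set_mult)
    then show ?case by (intro exI[of _ "{\<one>}"]) auto
  next
    case (Suc n)
    then obtain M where M: "finite M" "M \<subseteq> carrier G"
      "\<And>F. finite F \<Longrightarrow> F \<subseteq> carrier G \<Longrightarrow> (1 + e) ^ n * real (card F) \<le> real (card (F <#> M))"
      by blast
    have "(1 + e) ^ Suc n * real (card F) \<le> real (card (F <#> (M <#> L)))"
      if F: "finite F" "F \<subseteq> carrier G" for F
    proof -
      have "(1 + e) ^ Suc n * real (card F) \<le> (1 + e) * real (card (F <#> M))"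
        using mult_left_mono[OF M(3)[OF F], of "1 + e"] e by (simp add: mult.assoc)
      also have "\<dots> \<le> real (card (F <#> M <#> L))"
        using F M by (intro expand fin_mult setmult_subset_G)
      also have "F <#> M <#> L = F <#> (M <#> L)" using F M L by (intro set_mult_assoc)
      finally show ?thesis .
    qed
    then show ?case
      using M L by (intro exI[of _ "M <#> L"]) (simp add: fin_mult setmult_subset_G)
  qed
  obtain n where n: "2 < (1 + e) ^ n" using real_arch_pow[of "1 + e" 2] e by auto
  obtain M where M: "finite M" "M \<subseteq> carrier G"
    and grow: "\<And>F. finite F \<Longrightarrow> F \<subseteq> carrier G \<Longrightarrow> (1 + e) ^ n * real (card F) \<le> real (card (F <#> M))"
    using pow[of n] by blast
  \<comment> \<open>The boolean labels two copies of \<open>G\<close>. Injecting both into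
    \<open>G\<close> by right factors from \<open>M\<close> doubles the group inside itself; the
    growth factor 2 pays for the two copies in Hall's condition.\<close>
  let ?I = "carrier G \<times> (UNIV :: bool set)"
  obtain f where f: "inj_on f ?I" "\<forall>p\<in>?I. f p \<in> fst p <# M"
  proof (rule exE)
    show "\<exists>f. inj_on f ?I \<and> (\<forall>p\<in>?I. f p \<in> fst p <# M)"
    proof (rule infinite_Hall)
      fix J assume J: "finite J" "J \<subseteq> ?I"
      let ?F = "fst ` J"
      have F: "finite ?F" "?F \<subseteq> carrier G" using J by auto
      have "card J \<le> card (?F \<times> (UNIV :: bool set))"
        using F by (intro card_mono) (auto simp: subset_iff image_iff intro: bexI[rotated])
      then have "real (card J) \<le> 2 * real (card ?F)" by (simp add: card_cartesian_product)
      also have "\<dots> \<le> (1 + e) ^ n * real (card ?F)" using n by (intro mult_right_mono) auto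
      also have "\<dots> \<le> real (card (?F <#> M))" by (rule grow[OF F])
      also have "?F <#> M = (\<Union>p\<in>J. fst p <# M)" by (auto simp: set_mult_def l_coset_def)
      finally show "card J \<le> card (\<Union>p\<in>J. fst p <# M)" by simp
    qed (use M in \<open>simp add: l_coset_def\<close>)
  qed blast
  have fM: "\<exists>m\<in>M. f (g, b) = g \<otimes> m" if "g \<in> carrier G" for g b
    using bspec[OF f(2), of "(g, b)"] that by (auto simp: l_coset_def)
  obtain \<nu> where pos: "\<And>E. E \<subseteq> carrier G \<Longrightarrow> 0 \<le> \<nu> E" and one: "\<nu> (carrier G) = (1 :: real)"
    and add: "\<And>E E'. E \<subseteq> carrier G \<Longrightarrow> E' \<subseteq> carrier G \<Longrightarrow> E \<inter> E' = {} \<Longrightarrow> \<nu> (E \<union> E') = \<nu> E + \<nu> E'"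
    and inv: "\<And>g E. g \<in> carrier G \<Longrightarrow> E \<subseteq> carrier G \<Longrightarrow> \<nu> (E #> g) = \<nu> E"
    by (fact amenable_right_invariant[OF am])
  define E where "E = (\<lambda>(b, m). {g \<in> carrier G. f (g, b) = g \<otimes> m})"
  have E: "E p \<subseteq> carrier G" for p by (auto simp: E_def split: prod.splits)
  have "\<nu> (\<Union>m\<in>M. E (b, m)) = (\<Sum>m\<in>M. \<nu> (E (b, m)))" for b
  proof (rule finite_additivity[where X = "carrier G" and \<mu> = \<nu> and D = "\<lambda>m. E (b, m)", OF add])
    fix m m' assume "m \<in> M" "m' \<in> M" "m \<noteq> m'"
    moreover from this M have "g \<otimes> m \<noteq> g \<otimes> m'" if "g \<in> carrier G" for g
      using that by (simp add: subset_iff)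
    ultimately show "E (b, m) \<inter> E (b, m') = {}"
      by (fastforce simp: E_def)
  qed (use M E in auto)
  moreover have "(\<Union>m\<in>M. E (b, m)) = carrier G" for b
    using fM by (auto simp: E_def)
  ultimately have sum1: "(\<Sum>m\<in>M. \<nu> (E (b, m))) = 1" for b using one by simp
  \<comment> \<open>For fixed \<open>b\<close> the pieces \<open>E (b, m)\<close> partition
    \<open>G\<close>. Their images \<open>D p\<close> are disjoint because \<open>f\<close> is
    injective and keep their measure by right invariance, so measure 2 is packed into a set of
    measure 1.\<close>
  define D where "D = (\<lambda>p. E p #> snd p)"
  have D: "D p \<subseteq> carrier G" if "p \<in> UNIV \<times> M" for p
    using E[of p] M that unfolding D_def by (intro r_coset_subset_G) auto
  have "\<nu> (\<Union>p\<in>UNIV \<times> M. D p) = (\<Sum>p\<in>UNIV \<times> M. \<nu> (D p))"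
  proof (rule finite_additivity[where X = "carrier G" and \<mu> = \<nu> and D = D, OF add])
    fix p q :: "bool \<times> 'a" assume pq: "p \<in> UNIV \<times> M" "q \<in> UNIV \<times> M" "p \<noteq> q"
    show "D p \<inter> D q = {}"
    proof (rule ccontr)
      assume "D p \<inter> D q \<noteq> {}"
      then obtain g h where gh: "g \<in> E p" "h \<in> E q" "g \<otimes> snd p = h \<otimes> snd q"
        by (auto simp: D_def r_coset_def)
      then have "f (g, fst p) = f (h, fst q)" "g \<in> carrier G" "h \<in> carrier G"
        by (auto simp: E_def split: prod.splits)
      then have "(g, fst p) = (h, fst q)" using inj_onD[OF f(1)] by blast
      moreover have "snd p \<in> carrier G" "snd q \<in> carrier G" using pq M by auto
      ultimately have "snd p = snd q" using gh(3) \<open>g \<in> carrier G\<close> by simp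
      then show False using \<open>(g, fst p) = (h, fst q)\<close> pq(3) by (simp add: prod_eq_iff)
    qed
  qed (use M D in auto)
  also have "\<dots> = (\<Sum>p\<in>UNIV \<times> M. \<nu> (E p))"
    using inv E M by (intro sum.cong) (auto simp: D_def)
  also have "\<dots> = (\<Sum>b\<in>UNIV. \<Sum>m\<in>M. \<nu> (E (b, m)))"
    by (simp add: sum.cartesian_product)
  also have "\<dots> = 2" by (simp add: sum1)
  finally have two: "\<nu> (\<Union>p\<in>UNIV \<times> M. D p) = 2" .
  let ?U = "\<Union>p\<in>UNIV \<times> M. D p"
  have U: "?U \<subseteq> carrier G" using D by blast
  then have "\<nu> (?U \<union> (carrier G - ?U)) = \<nu> ?U + \<nu> (carrier G - ?U)" by (intro add) auto
  moreover have "?U \<union> (carrier G - ?U) = carrier G" using U by blast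
  moreover have "0 \<le> \<nu> (carrier G - ?U)" by (intro pos) auto
  ultimately show False using two one by simp
qed

section \<open>Folner nets of a group and of its subgroups\<close>

lemma net_filter_neq_bot: "directed_index I r \<Longrightarrow> net_filter I r \<noteq> bot"
  unfolding trivial_limit_def
  by (subst eventually_net_filter) (auto simp: directed_index_def dest: reflp_onD)

text \<open>An index \<open>(K, n)\<close> is a demand: \<open>K\<close> holds the elements to be
  tested and 1/(n+1) is the tolerance. The index type is the one over which \<open>H_alg\<close>
  quantifies.\<close>

lemma (in group) ex_right_folner_net:
  assumes "amenable G"
  shows "\<exists>(I :: ('a set \<times> nat) set) r F. right_folner_net G I r F"
proof -
  define I where "I = {(K, n :: nat). finite K \<and> K \<subseteq> carrier G}"
  define r where "r = (\<lambda>(K, n :: nat) (K' :: 'a set, n'). K \<subseteq> K' \<and> n \<le> n')"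
  have dI: "directed_index I r"
    unfolding directed_index_def
  proof (intro conjI ballI)
    show "I \<noteq> {}" by (auto simp: I_def)
    show "reflp_on I r" by (auto simp: r_def reflp_on_def)
    show "transp_on I r" by (auto simp: r_def transp_on_def)
    fix a b assume "a \<in> I" "b \<in> I"
    then show "\<exists>k\<in>I. r a k \<and> r b k"
      by (intro bexI[of _ "(fst a \<union> fst b, max (snd a) (snd b))"]) (auto simp: I_def r_def)
  qed
  define Q where "Q = (\<lambda>p F. finite F \<and> F \<noteq> {} \<and> F \<subseteq> carrier G \<and>
    (\<forall>g\<in>fst p. real (card ((F #> g) - F)) < 1 / real (Suc (snd p)) * real (card F)))"
  define F where "F = (\<lambda>p. SOME F. Q p F)"
  have F: "Q p (F p)" if "p \<in> I" for p
  proof -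
    have "\<exists>F. Q p F"
      unfolding Q_def using that by (intro amenable_folner_set assms) (auto simp: I_def)
    then show ?thesis unfolding F_def by (rule someI_ex)
  qed
  have "right_folner_net G I r F"
    unfolding right_folner_net_def
  proof (intro conjI ballI)
    fix p assume "p \<in> I"
    then show "finite (F p)" "F p \<noteq> {}" "F p \<subseteq> carrier G" using F by (auto simp: Q_def)
  next
    fix g assume g: "g \<in> carrier G"
    show "((\<lambda>p. real (card ((F p #> g) - F p)) / real (card (F p))) \<longlongrightarrow> 0) (net_filter I r)"
    proof (rule tendstoI)
      fix d :: real assume "d > 0"
      then obtain n where n: "1 / real (Suc n) < d" using nat_approx_posE by blast
      have "dist (real (card ((F p #> g) - F p)) / real (card (F p))) 0 < d"
        if p: "p \<in> I" "r ({g}, n) p" for p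
      proof -
        have Qp: "Q p (F p)" by (rule F[OF p(1)])
        then have "card (F p) > 0" by (auto simp: Q_def card_gt_0_iff)
        moreover have "g \<in> fst p" using p(2) by (auto simp: r_def split: prod.splits)
        ultimately have "real (card ((F p #> g) - F p)) / real (card (F p)) < 1 / real (Suc (snd p))"
          using Qp by (simp add: Q_def divide_simps)
        also have "\<dots> \<le> 1 / real (Suc n)"
          using p(2) by (intro divide_left_mono) (auto simp: r_def split: prod.splits)
        finally show ?thesis using n by simp
      qed
      moreover have "({g}, n) \<in> I" using g by (simp add: I_def)
      ultimately show "\<forall>\<^sub>F p in net_filter I r.
          dist (real (card ((F p #> g) - F p)) / real (card (F p))) 0 < d"
        unfolding eventually_net_filter[OF dI] by blast
    qed
  qed (use dI in auto)
  then show ?thesis by blast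
qed

text \<open>Needed for the Folner nets of \<open>N\<close> along which the entropy of the restricted
  action is taken. The mean is transferred instead of a net, since it can be pushed along a
  map.\<close>

lemma (in group) amenable_subgroup:
  assumes am: "amenable G" and N: "subgroup N G"
  shows "amenable (G\<lparr>carrier := N\<rparr>)"
proof -
  interpret N: subgroup N G by (rule N)
  obtain \<mu> :: "'a set \<Rightarrow> real" where
    pos: "\<And>E. E \<subseteq> carrier G \<Longrightarrow> 0 \<le> \<mu> E" and one: "\<mu> (carrier G) = 1"
    and add: "\<And>E E'. E \<subseteq> carrier G \<Longrightarrow> E' \<subseteq> carrier G \<Longrightarrow> E \<inter> E' = {} \<Longrightarrow> \<mu> (E \<union> E') = \<mu> E + \<mu> E'"
    and inv: "\<And>g E. g \<in> carrier G \<Longrightarrow> E \<subseteq> carrier G \<Longrightarrow> \<mu> (g <# E) = \<mu> E"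
    by (fact amenableE[OF am])
  \<comment> \<open>\<open>\<pi>\<close> is an \<open>N\<close>-equivariant map onto \<open>N\<close>, along which the mean of \<open>G\<close> is pushed forward.\<close>
  define rep where "rep = (\<lambda>g. SOME x. x \<in> N #> g)"
  define \<pi> where "\<pi> = (\<lambda>g. g \<otimes> inv (rep g))"
  have rep: "rep g \<in> N #> g" if "g \<in> carrier G" for g
    unfolding rep_def using N.subgroup_axioms rcos_self[OF that] by (metis someI)
  have repG: "rep g \<in> carrier G" if "g \<in> carrier G" for g
    using rep[OF that] r_coset_subset_G[OF N.subset that] by blast
  have \<pi>N: "\<pi> g \<in> N" if g: "g \<in> carrier G" for g
  proof -
    obtain n where n: "n \<in> N" "rep g = n \<otimes> g" using rep[OF g] by (auto simp: r_coset_def)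
    then have "\<pi> g = inv n" using g by (simp add: \<pi>_def inv_mult_group m_assoc[symmetric])
    then show ?thesis using n by simp
  qed
  \<comment> \<open>\<open>rep\<close> is chosen from the coset as a set, so it is constant on each
    coset and left multiplication by \<open>n\<close> affects only the other factor of
    \<open>\<pi>\<close>.\<close>
  have equiv: "\<pi> (n \<otimes> g) = n \<otimes> \<pi> g" if "n \<in> N" "g \<in> carrier G" for n g
  proof -
    have "N #> (n \<otimes> g) = N #> g"
      using that N by (metis N.mem_carrier N.subset coset_mult_assoc coset_join2)
    then have "rep (n \<otimes> g) = rep g" by (simp add: rep_def)
    then show ?thesis using that repG by (simp add: \<pi>_def m_assoc)
  qed
  define P where "P = (\<lambda>E. {g \<in> carrier G. \<pi> g \<in> E})"
  have P: "P E \<subseteq> carrier G" for E by (auto simp: P_def)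
  have trans: "P (n <# E) = n <# P E" if n: "n \<in> N" and E: "E \<subseteq> N" for n E
  proof (intro subset_antisym subsetI)
    fix g assume "g \<in> P (n <# E)"
    then obtain x where x: "g \<in> carrier G" "x \<in> E" "\<pi> g = n \<otimes> x"
      by (auto simp: P_def l_coset_def)
    have "\<pi> (inv n \<otimes> g) = x"
      using x n E by (simp add: equiv m_assoc[symmetric] subset_iff)
    then have "inv n \<otimes> g \<in> P E" using x n by (simp add: P_def)
    moreover have "g = n \<otimes> (inv n \<otimes> g)" using x n by (simp add: m_assoc[symmetric])
    ultimately show "g \<in> n <# P E" by (auto simp: l_coset_def)
  next
    fix g assume "g \<in> n <# P E"
    then show "g \<in> P (n <# E)" using n by (auto simp: P_def l_coset_def equiv)
  qed
  show ?thesis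
    unfolding amenable_def
  proof (intro exI[of _ "\<lambda>E. \<mu> (P E)"] conjI allI impI ballI)
    show "0 \<le> \<mu> (P E)" for E by (rule pos[OF P])
    have "P N = carrier G" using \<pi>N by (auto simp: P_def)
    then show "\<mu> (P (carrier (G\<lparr>carrier := N\<rparr>))) = 1" using one by simp
    show "\<mu> (P (E \<union> E')) = \<mu> (P E) + \<mu> (P E')" if "E \<inter> E' = {}" for E E'
    proof -
      have "P (E \<union> E') = P E \<union> P E'" "P E \<inter> P E' = {}" using that by (auto simp: P_def)
      then show ?thesis using add P by simp
    qed
    show "\<mu> (P (g <#\<^bsub>G\<lparr>carrier := N\<rparr>\<^esub> E)) = \<mu> (P E)"
      if "g \<in> carrier (G\<lparr>carrier := N\<rparr>)" "E \<subseteq> carrier (G\<lparr>carrier := N\<rparr>)" for g E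
      using that inv P by (simp add: trans)
  qed
qed

section \<open>Shearer's inequality for sumsets\<close>

text \<open>The hypothesis bounds \<open>x\<close> by the geometric mean of the \<open>y j\<close>,
  so AM-GM applies.\<close>

lemma prod_bounded_imp_le_mean:
  fixes y :: "'j \<Rightarrow> real"
  assumes J: "finite J" "J \<noteq> {}" and y: "\<And>j. j \<in> J \<Longrightarrow> 0 \<le> y j"
    and x: "0 \<le> x" "x ^ card J \<le> (\<Prod>j\<in>J. y j)"
  shows "x \<le> (\<Sum>j\<in>J. y j) / real (card J)"
proof (cases "x = 0")
  case True
  then show ?thesis using y by (simp add: sum_nonneg)
next
  case False
  then have pos: "0 < x" using x by simp
  have k: "card J > 0" using J by (simp add: card_gt_0_iff)
  have "x = (x ^ card J) powr (1 / real (card J))"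
    using pos k by (simp add: powr_realpow[symmetric] powr_powr)
  also have "\<dots> \<le> (\<Prod>j\<in>J. y j) powr (1 / real (card J))"
    using x by (intro powr_mono2) auto
  also have "\<dots> \<le> (\<Sum>j\<in>J. y j / real (card J))"
    by (rule arith_geom_mean[OF J y])
  finally show ?thesis by (simp add: sum_divide_distrib)
qed

text \<open>Generalised Hoelder inequality with \<open>card J\<close> equal exponents, in root-free
  form. The factor \<open>P\<close>, constant in \<open>v\<close>, will carry the covering sets that
  miss the coordinate being split off.\<close>

lemma Hoelder_prod:
  fixes n :: "'v \<Rightarrow> real" and a :: "'j \<Rightarrow> 'v \<Rightarrow> real"
  assumes V: "finite V" and J: "finite J" "J \<noteq> {}" and P: "0 \<le> P"
    and n: "\<And>v. v \<in> V \<Longrightarrow> 0 \<le> n v" and a: "\<And>j v. j \<in> J \<Longrightarrow> v \<in> V \<Longrightarrow> 0 \<le> a j v"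
    and le: "\<And>v. v \<in> V \<Longrightarrow> n v ^ card J \<le> P * (\<Prod>j\<in>J. a j v)"
  shows "(\<Sum>v\<in>V. n v) ^ card J \<le> P * (\<Prod>j\<in>J. \<Sum>v\<in>V. a j v)"
proof -
  let ?k = "card J"
  define T where "T = (\<lambda>j. \<Sum>v\<in>V. a j v)"
  have k: "?k > 0" using J by (simp add: card_gt_0_iff)
  have T: "0 \<le> T j" if "j \<in> J" for j using a that by (auto simp: T_def intro: sum_nonneg)
  show ?thesis
  proof (cases "P = 0 \<or> (\<exists>j\<in>J. T j = 0)")
    case True
    have "n v = 0" if v: "v \<in> V" for v
    proof -
      have zero: "P * (\<Prod>j\<in>J. a j v) = 0"
      proof (cases "P = 0")
        case False
        then obtain j where j: "j \<in> J" "T j = 0" using True by blast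
        then have "a j v = 0" using a v V by (simp add: T_def sum_nonneg_eq_0_iff)
        then show ?thesis using j J by (metis mult_zero_right prod_zero)
      qed simp
      then have "n v ^ ?k \<le> 0" using le[OF v] by (simp only: zero)
      then show ?thesis using n[OF v] k by (metis antisym zero_le_power power_eq_0_iff)
    qed
    then have "(\<Sum>v\<in>V. n v) ^ ?k = 0" using k by simp
    also have "0 \<le> P * (\<Prod>j\<in>J. T j)" using P T by (intro mult_nonneg_nonneg prod_nonneg) auto
    finally show ?thesis by (simp add: T_def)
  next
    case False
    then have P0: "0 < P" and T0: "\<And>j. j \<in> J \<Longrightarrow> 0 < T j" using P T by (auto simp: less_le)
    define R where "R = P * (\<Prod>j\<in>J. T j)"
    have R: "0 < R" unfolding R_def using P0 T0 by (intro mult_pos_pos prod_pos) auto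
    \<comment> \<open>\<open>\<rho>\<close> is the bound sought for the sum. With \<open>n\<close>
      scaled by \<open>\<rho>\<close> and each \<open>a j\<close> by its total \<open>T j\<close>,
      the claim is that a sum is at most 1, and AM-GM at each \<open>v\<close> yields it.\<close>
    define \<rho> where "\<rho> = root ?k R"
    have \<rho>: "0 < \<rho>" "\<rho> ^ ?k = R" using R k by (auto simp: \<rho>_def)
    have le_mean: "n v / \<rho> \<le> (\<Sum>j\<in>J. a j v / T j) / real ?k" if v: "v \<in> V" for v
    proof (rule prod_bounded_imp_le_mean[OF J])
      have "(n v / \<rho>) ^ ?k \<le> P * (\<Prod>j\<in>J. a j v) / R"
        using le[OF v] R by (simp add: power_divide \<rho>(2) divide_right_mono)
      also have "\<dots> = (\<Prod>j\<in>J. a j v / T j)" using P0 by (simp add: R_def prod_dividef)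
      finally show "(n v / \<rho>) ^ ?k \<le> (\<Prod>j\<in>J. a j v / T j)" .
    qed (use n a v \<rho> T in auto)
    have "(\<Sum>v\<in>V. n v) / \<rho> = (\<Sum>v\<in>V. n v / \<rho>)" by (simp add: sum_divide_distrib)
    also have "\<dots> \<le> (\<Sum>v\<in>V. (\<Sum>j\<in>J. a j v / T j) / real ?k)" by (rule sum_mono[OF le_mean])
    also have "\<dots> = (\<Sum>j\<in>J. (\<Sum>v\<in>V. a j v) / T j) / real ?k"
      by (simp only: sum_divide_distrib[symmetric] sum.swap[of "\<lambda>v j. a j v / T j" J V])
    also have "(\<Sum>j\<in>J. (\<Sum>v\<in>V. a j v) / T j) = (\<Sum>j\<in>J. 1)"
    proof (rule sum.cong)
      fix j assume "j \<in> J"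
      then have "T j \<noteq> 0" using T0 by force
      then show "(\<Sum>v\<in>V. a j v) / T j = 1" by (simp add: T_def)
    qed simp
    also have "(\<Sum>j\<in>J. 1) / real ?k = (1 :: real)" using k by simp
    finally have "(\<Sum>v\<in>V. n v) \<le> \<rho>" using \<rho> by (simp add: divide_simps)
    then have "(\<Sum>v\<in>V. n v) ^ ?k \<le> \<rho> ^ ?k" using n by (intro power_mono sum_nonneg) auto
    then show ?thesis using \<rho>(2) by (simp add: R_def T_def)
  qed
qed

text \<open>Projections are sorted by their value at \<open>i\<close>. Inside one fibre that
  coordinate is constant, so forgetting it identifies no two of them.\<close>

lemma card_restrict_insert:
  assumes B: "finite B" and i: "i \<notin> S"
  shows "card ((\<lambda>b. restrict b (insert i S)) ` B) =
    (\<Sum>v\<in>(\<lambda>b. b i) ` B. card ((\<lambda>b. restrict b S) ` {b \<in> B. b i = v}))"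
proof -
  let ?p = "\<lambda>b. restrict b (insert i S)"
  have "?p ` B = (\<Union>v\<in>(\<lambda>b. b i) ` B. ?p ` {b \<in> B. b i = v})" by auto
  also have "card \<dots> = (\<Sum>v\<in>(\<lambda>b. b i) ` B. card (?p ` {b \<in> B. b i = v}))"
  proof (rule card_UN_disjoint)
    show "\<forall>v\<in>(\<lambda>b. b i) ` B. \<forall>w\<in>(\<lambda>b. b i) ` B. v \<noteq> w \<longrightarrow>
        ?p ` {b \<in> B. b i = v} \<inter> ?p ` {b \<in> B. b i = w} = {}"
      by (auto simp: restrict_def fun_eq_iff) metis
  qed (use B in auto)
  also have "\<dots> = (\<Sum>v\<in>(\<lambda>b. b i) ` B. card ((\<lambda>b. restrict b S) ` {b \<in> B. b i = v}))"
  proof (rule sum.cong)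
    fix v
    have "bij_betw (\<lambda>f. restrict f S) (?p ` {b \<in> B. b i = v}) ((\<lambda>b. restrict b S) ` {b \<in> B. b i = v})"
      unfolding bij_betw_def
    proof
      show "inj_on (\<lambda>f. restrict f S) (?p ` {b \<in> B. b i = v})"
      proof (rule inj_onI)
        fix f f' assume f: "f \<in> ?p ` {b \<in> B. b i = v}" "f' \<in> ?p ` {b \<in> B. b i = v}"
          and eq: "restrict f S = restrict f' S"
        obtain b b' where b: "f = ?p b" "f' = ?p b'" "b i = b' i" using f by auto
        have "f x = f' x" for x
        proof (cases "x \<in> S")
          case True
          then show ?thesis using fun_cong[OF eq, of x] by simp
        next
          case False
          then show ?thesis using b by (cases "x = i") auto
        qed
        then show "f = f'" by blast
      qed
      have "restrict (?p b) S = restrict b S" for b :: "'a \<Rightarrow> 'b" by (auto simp: restrict_def)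
      then show "(\<lambda>f. restrict f S) ` ?p ` {b \<in> B. b i = v} = (\<lambda>b. restrict b S) ` {b \<in> B. b i = v}"
        by (simp add: image_image)
    qed
    then show "card (?p ` {b \<in> B. b i = v}) = card ((\<lambda>b. restrict b S) ` {b \<in> B. b i = v})"
      by (rule bij_betw_same_card)
  qed simp
  finally show ?thesis .
qed

text \<open>The combinatorial form of Shearer's entropy inequality, by induction on the index set: split
  \<open>B\<close> by the value at the new index and apply Hoelder's inequality to the \<open>k\<close> sets that contain it.\<close>

lemma Shearer_card:
  fixes B :: "('i \<Rightarrow> 'x) set" and S :: "'c \<Rightarrow> 'i set"
  assumes F: "finite F" and C: "finite C" and k: "k > 0"
    and cover: "\<And>i. i \<in> F \<Longrightarrow> card {c \<in> C. i \<in> S c} = k"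
    and B: "finite B"
  shows "card ((\<lambda>b. restrict b F) ` B) ^ k \<le> (\<Prod>c\<in>C. card ((\<lambda>b. restrict b (F \<inter> S c)) ` B))"
  using F cover B
proof (induction F arbitrary: B rule: finite_induct)
  case empty
  \<comment> \<open>All projections to the empty set coincide, so both sides are 1 for nonempty
    \<open>B\<close>. For empty \<open>B\<close> the left side is \<open>0 ^ k\<close>, which is 0
    because \<open>k > 0\<close>.\<close>
  have "restrict b {} = (\<lambda>_. undefined)" for b :: "'i \<Rightarrow> 'x" by (simp add: restrict_def)
  then show ?case using k by (cases "B = {}") (simp_all add: image_constant_conv zero_power)
next
  case (insert i F)
  let ?N = "\<lambda>S B. card ((\<lambda>b. restrict b S) ` B)"
  define V where "V = (\<lambda>b. b i) ` B"
  define fib where "fib = (\<lambda>v. {b \<in> B. b i = v})"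
  define J where "J = {c \<in> C. i \<in> S c}"
  have V: "finite V" and fib: "finite (fib v)" for v using insert.prems by (auto simp: V_def fib_def)
  have J: "finite J" "card J = k" using C insert.prems(1)[of i] by (auto simp: J_def)
  have J0: "J \<noteq> {}" using J k by auto
  have split: "?N (insert i T) B = (\<Sum>v\<in>V. ?N T (fib v))" if "i \<notin> T" for T
    using card_restrict_insert[OF insert.prems(2) that] by (simp add: V_def fib_def)
  \<comment> \<open>For sets of the cover that miss \<open>i\<close>, the projections of a fibre are
    bounded by those of all of \<open>B\<close>. This removes the dependence on \<open>v\<close>, so
    that Hoelder's inequality sees exactly \<open>k\<close> varying factors.\<close>
  define P where "P = (\<Prod>c\<in>C - J. ?N (F \<inter> S c) B)"
  have fib_le: "?N F (fib v) ^ k \<le> P * (\<Prod>c\<in>J. ?N (F \<inter> S c) (fib v))" for v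
  proof -
    have "?N F (fib v) ^ k \<le> (\<Prod>c\<in>C. ?N (F \<inter> S c) (fib v))"
      using insert.prems(1) fib by (intro insert.IH) auto
    also have "\<dots> = (\<Prod>c\<in>C - J. ?N (F \<inter> S c) (fib v)) * (\<Prod>c\<in>J. ?N (F \<inter> S c) (fib v))"
      using C by (intro prod.subset_diff) (auto simp: J_def)
    also have "\<dots> \<le> P * (\<Prod>c\<in>J. ?N (F \<inter> S c) (fib v))"
      unfolding P_def using insert.prems(2)
      by (intro mult_right_mono prod_mono conjI card_mono image_mono) (auto simp: fib_def)
    finally show ?thesis .
  qed
  have "(\<Sum>v\<in>V. real (?N F (fib v))) ^ card J \<le>
      real P * (\<Prod>c\<in>J. \<Sum>v\<in>V. real (?N (F \<inter> S c) (fib v)))"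
  proof (rule Hoelder_prod[OF V J(1) J0])
    fix v
    have "real (?N F (fib v) ^ k) \<le> real (P * (\<Prod>c\<in>J. ?N (F \<inter> S c) (fib v)))"
      using fib_le[of v] by (rule of_nat_mono)
    then show "real (?N F (fib v)) ^ card J \<le> real P * (\<Prod>c\<in>J. real (?N (F \<inter> S c) (fib v)))"
      by (simp add: J(2))
  qed auto
  then have "real ((\<Sum>v\<in>V. ?N F (fib v)) ^ k) \<le> real (P * (\<Prod>c\<in>J. \<Sum>v\<in>V. ?N (F \<inter> S c) (fib v)))"
    by (simp add: J(2))
  then have "(\<Sum>v\<in>V. ?N F (fib v)) ^ k \<le> P * (\<Prod>c\<in>J. \<Sum>v\<in>V. ?N (F \<inter> S c) (fib v))"
    by (simp only: of_nat_le_iff)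
  moreover have "(\<Sum>v\<in>V. ?N (F \<inter> S c) (fib v)) = ?N (insert i F \<inter> S c) B" if "c \<in> J" for c
  proof -
    have "insert i F \<inter> S c = insert i (F \<inter> S c)" using that by (auto simp: J_def)
    then show ?thesis using split[of "F \<inter> S c"] insert.hyps by simp
  qed
  moreover have "P = (\<Prod>c\<in>C - J. ?N (insert i F \<inter> S c) B)"
    unfolding P_def by (intro prod.cong refl) (auto simp: J_def Int_insert_left)
  moreover have "(\<Prod>c\<in>C. ?N (insert i F \<inter> S c) B) =
      (\<Prod>c\<in>C - J. ?N (insert i F \<inter> S c) B) * (\<Prod>c\<in>J. ?N (insert i F \<inter> S c) B)"
    using C by (intro prod.subset_diff) (auto simp: J_def)
  ultimately show ?case by (simp only: split[OF insert.hyps(2)] cong: prod.cong)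
qed

section \<open>Sumsets and their tuples\<close>

text \<open>\<open>trajectory\<close> quantifies over functions with arbitrary values off
  \<open>F\<close>; extensional tuples give a finite domain instead. In this locale \<open>G\<close>
  is the structure acted upon, not the acting group.\<close>

lemma (in comm_monoid) trajectory_eq_image:
  assumes "\<And>g. g \<in> F \<Longrightarrow> \<alpha> g ` X \<subseteq> carrier G"
  shows "trajectory G \<alpha> F X = (\<lambda>x. \<Otimes>g\<in>F. x g) ` (\<Pi>\<^sub>E g\<in>F. \<alpha> g ` X)"
proof (intro subset_antisym subsetI)
  fix t assume "t \<in> trajectory G \<alpha> F X"
  then obtain x where x: "t = (\<Otimes>g\<in>F. x g)" "\<And>g. g \<in> F \<Longrightarrow> x g \<in> \<alpha> g ` X"
    by (auto simp: trajectory_def)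
  have "(\<Otimes>g\<in>F. x g) = (\<Otimes>g\<in>F. restrict x F g)"
    using x(2) assms by (intro finprod_cong' funcsetI) (fastforce | simp)+
  then show "t \<in> (\<lambda>x. \<Otimes>g\<in>F. x g) ` (\<Pi>\<^sub>E g\<in>F. \<alpha> g ` X)"
    using x by (intro image_eqI[of _ _ "restrict x F"]) (auto simp: restrict_PiE_iff)
next
  fix t assume "t \<in> (\<lambda>x. \<Otimes>g\<in>F. x g) ` (\<Pi>\<^sub>E g\<in>F. \<alpha> g ` X)"
  then show "t \<in> trajectory G \<alpha> F X" unfolding trajectory_def by (auto simp: PiE_iff)
qed

lemma (in comm_monoid) finite_trajectory:
  assumes "finite F" "finite X" "\<And>g. g \<in> F \<Longrightarrow> \<alpha> g ` X \<subseteq> carrier G"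
  shows "finite (trajectory G \<alpha> F X)"
  using assms by (simp add: trajectory_eq_image finite_PiE)

lemma (in comm_monoid) trajectory_subset:
  assumes "\<And>g. g \<in> F \<Longrightarrow> \<alpha> g ` X \<subseteq> carrier G"
  shows "trajectory G \<alpha> F X \<subseteq> carrier G"
proof
  fix t assume "t \<in> trajectory G \<alpha> F X"
  then obtain x where x: "t = (\<Otimes>g\<in>F. x g)" "\<And>g. g \<in> F \<Longrightarrow> x g \<in> \<alpha> g ` X"
    by (auto simp: trajectory_def)
  have "(\<Otimes>g\<in>F. x g) \<in> carrier G" using x(2) assms by (intro finprod_closed) blast
  then show "t \<in> carrier G" by (simp add: x(1))
qed

lemma (in comm_monoid) finprod_split:
  assumes "finite F" "D \<subseteq> F" "\<And>g. g \<in> F \<Longrightarrow> x g \<in> carrier G"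
  shows "(\<Otimes>g\<in>F. x g) = (\<Otimes>g\<in>D. x g) \<otimes> (\<Otimes>g\<in>F - D. x g)"
proof -
  have "(\<Otimes>g\<in>D \<union> (F - D). x g) = (\<Otimes>g\<in>D. x g) \<otimes> (\<Otimes>g\<in>F - D. x g)"
    using assms by (intro finprod_Un_disjoint) (auto intro: finite_subset)
  then show ?thesis using assms(2) by (simp add: Un_absorb1)
qed

text \<open>Every element of the sumset is represented by the tuple of least binary weight. A partial sum of
  such a representation determines the corresponding partial tuple, since otherwise exchanging the
  parts would lower the weight; so Shearer's inequality for tuples carries over to sumsets.\<close>

lemma (in comm_group) Shearer_trajectory:
  fixes \<alpha> :: "'i \<Rightarrow> 'a \<Rightarrow> 'a"
  assumes F: "finite F" and X: "finite X" and Y: "\<And>g. g \<in> F \<Longrightarrow> \<alpha> g ` X \<subseteq> carrier G"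
    and C: "finite C" and k: "k > 0" and cover: "\<And>g. g \<in> F \<Longrightarrow> card {c \<in> C. g \<in> S c} = k"
  shows "card (trajectory G \<alpha> F X) ^ k \<le> (\<Prod>c\<in>C. card (trajectory G \<alpha> (F \<inter> S c) X))"
proof -
  define Tup where "Tup = (\<Pi>\<^sub>E g\<in>F. \<alpha> g ` X)"
  have finTup: "finite Tup" using F X by (simp add: Tup_def finite_PiE)
  have mem: "x g \<in> \<alpha> g ` X" if "x \<in> Tup" "g \<in> F" for x g using that by (auto simp: Tup_def)
  have car: "x g \<in> carrier G" if "x \<in> Tup" "g \<in> F" for x g using mem[OF that] Y[OF that(2)] by blast
  have finS: "finite (Sigma F (\<lambda>g. \<alpha> g ` X))" using F X by auto
  \<comment> \<open>Numbering pairs instead of values keeps equal values at different indices apart,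
    so a tuple occupies distinct binary digits.\<close>
  obtain e :: "'i \<times> 'a \<Rightarrow> nat" where e: "inj_on e (Sigma F (\<lambda>g. \<alpha> g ` X))"
    using finite_imp_inj_to_nat_seg[OF finS] by blast
  define code where "code = (\<lambda>D x. (\<lambda>g. e (g, x g)) ` D)"
  \<comment> \<open>The weight must be additive over disjoint index sets, for the exchange, and must
    determine the code set, for uniqueness; a sum of distinct powers of 2 does both.\<close>
  define W where "W = (\<lambda>D x. \<Sum>g\<in>D. 2 ^ e (g, x g) :: nat)"
  have e_eq: "g = h \<and> x g = y h" if "e (g, x g) = e (h, y h)" "x \<in> Tup" "y \<in> Tup" "g \<in> F" "h \<in> F" for g h x y
  proof -
    have "(g, x g) = (h, y h)" by (rule inj_onD[OF e that(1)]) (use mem that in auto)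
    then show ?thesis by blast
  qed
  have W_code: "W D x = set_encode (code D x)" if D: "D \<subseteq> F" "x \<in> Tup" for D x
  proof -
    have "inj_on (\<lambda>g. e (g, x g)) D" using e_eq D by (intro inj_onI) blast
    then show ?thesis by (simp add: W_def code_def set_encode_def sum.reindex)
  qed
  have W_split: "W F x = W D x + W (F - D) x" if "D \<subseteq> F" for D x
    using that F by (simp add: W_def sum.subset_diff add.commute)
  define rep where "rep = (\<lambda>t. arg_min_on (W F) {x \<in> Tup. (\<Otimes>g\<in>F. x g) = t})"
  have T: "trajectory G \<alpha> F X = (\<lambda>x. \<Otimes>g\<in>F. x g) ` Tup"
    unfolding Tup_def using Y by (rule trajectory_eq_image)
  have rep: "rep t \<in> Tup" "(\<Otimes>g\<in>F. rep t g) = t"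
    and rep_min: "\<And>x. x \<in> Tup \<Longrightarrow> (\<Otimes>g\<in>F. x g) = t \<Longrightarrow> W F (rep t) \<le> W F x"
    if t: "t \<in> trajectory G \<alpha> F X" for t
  proof -
    let ?R = "{x \<in> Tup. (\<Otimes>g\<in>F. x g) = t}"
    have R: "finite ?R" "?R \<noteq> {}" using finTup t T by auto
    show "rep t \<in> Tup" "(\<Otimes>g\<in>F. rep t g) = t"
      using arg_min_if_finite(1)[OF R, of "W F"] by (auto simp: rep_def)
    show "W F (rep t) \<le> W F x" if "x \<in> Tup" "(\<Otimes>g\<in>F. x g) = t" for x
      unfolding rep_def by (rule arg_min_least[OF R]) (use that in simp)
  qed
  define B where "B = rep ` trajectory G \<alpha> F X"
  have finB: "finite B" using F X Y by (simp add: B_def finite_trajectory)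
  have BTup: "b \<in> Tup" if "b \<in> B" for b using that rep(1) by (auto simp: B_def)
  have B_min: "W F b \<le> W F x" if "b \<in> B" "x \<in> Tup" "(\<Otimes>g\<in>F. x g) = (\<Otimes>g\<in>F. b g)" for b x
  proof -
    obtain t where t: "t \<in> trajectory G \<alpha> F X" "b = rep t" using \<open>b \<in> B\<close> by (auto simp: B_def)
    then show ?thesis using rep_min[OF t(1) \<open>x \<in> Tup\<close>] rep(2)[OF t(1)] that(3) by simp
  qed
  have exchange: "W D b' \<le> W D b"
    if D: "D \<subseteq> F" and b: "b \<in> B" "b' \<in> B" and eq: "(\<Otimes>g\<in>D. b g) = (\<Otimes>g\<in>D. b' g)" for D b b'
  proof -
    \<comment> \<open>The hybrid follows \<open>b\<close> on \<open>D\<close> and \<open>b'\<close>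
      elsewhere. Its total sum is that of \<open>b'\<close>, so minimality of \<open>b'\<close>
      compares the two parts over \<open>D\<close>.\<close>
    define m where "m = (\<lambda>g. if g \<in> D then b g else b' g)"
    have mTup: "m \<in> Tup" unfolding Tup_def
    proof (rule PiE_I)
      show "m g \<in> \<alpha> g ` X" if "g \<in> F" for g
        using mem[OF BTup[OF b(1)] that] mem[OF BTup[OF b(2)] that] by (simp add: m_def)
      show "m g = undefined" if "g \<notin> F" for g
        using BTup[OF b(2)] that D unfolding Tup_def m_def by (auto simp: PiE_def extensional_def)
    qed
    have "(\<Otimes>g\<in>D. m g) = (\<Otimes>g\<in>D. b g)"
      using car[OF BTup[OF b(1)]] D by (intro finprod_cong') (auto simp: m_def)
    moreover have "(\<Otimes>g\<in>F - D. m g) = (\<Otimes>g\<in>F - D. b' g)"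
      using car[OF BTup[OF b(2)]] by (intro finprod_cong') (auto simp: m_def)
    ultimately have "(\<Otimes>g\<in>F. m g) = (\<Otimes>g\<in>F. b' g)"
      using finprod_split[OF F D car[OF mTup]] finprod_split[OF F D car[OF BTup[OF b(2)]]] eq by simp
    then have "W F b' \<le> W F m" using B_min[OF b(2) mTup] by simp
    moreover have "W D m = W D b" "W (F - D) m = W (F - D) b'"
      unfolding W_def by (auto intro!: sum.cong simp: m_def)
    ultimately show ?thesis using W_split[OF D, of m] W_split[OF D, of b'] by simp
  qed
  have determined: "b g = b' g"
    if D: "D \<subseteq> F" and b: "b \<in> B" "b' \<in> B" and eq: "(\<Otimes>g\<in>D. b g) = (\<Otimes>g\<in>D. b' g)" and g: "g \<in> D"
    for D b b' g
  proof -
    have "W D b = W D b'" using exchange[OF D b eq] exchange[OF D b(2,1) eq[symmetric]] by simp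
    moreover have "finite (code D x)" for x using finite_subset[OF D F] by (simp add: code_def)
    ultimately have "code D b = code D b'" using W_code[OF D] BTup b by (simp add: set_encode_eq)
    then have "e (g, b g) \<in> code D b'" using g by (auto simp: code_def)
    then obtain h where h: "h \<in> D" "e (g, b g) = e (h, b' h)" by (auto simp: code_def)
    then show ?thesis using e_eq[where x = b and y = b', OF h(2)] BTup b D g by blast
  qed
  have "card (trajectory G \<alpha> F X) \<le> card ((\<lambda>b. restrict b F) ` B)"
  proof (rule card_inj_on_le)
    have "restrict (rep t) F = rep t" if "t \<in> trajectory G \<alpha> F X" for t
      using rep(1)[OF that] by (auto simp: Tup_def PiE_iff extensional_restrict)
    then show "inj_on (\<lambda>t. restrict (rep t) F) (trajectory G \<alpha> F X)"
      using rep(2) by (intro inj_onI) metis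
  qed (use finB in \<open>auto simp: B_def\<close>)
  then have "card (trajectory G \<alpha> F X) ^ k \<le> card ((\<lambda>b. restrict b F) ` B) ^ k"
    by (rule power_mono) simp
  also have "\<dots> \<le> (\<Prod>c\<in>C. card ((\<lambda>b. restrict b (F \<inter> S c)) ` B))"
    by (rule Shearer_card[OF F C k cover finB])
  also have "\<dots> \<le> (\<Prod>c\<in>C. card (trajectory G \<alpha> (F \<inter> S c) X))"
  proof (intro prod_mono conjI)
    fix c
    let ?D = "F \<inter> S c"
    have sum_restrict: "(\<Otimes>g\<in>?D. restrict b ?D g) = (\<Otimes>g\<in>?D. b g)" if "b \<in> B" for b
      using car[OF BTup[OF that]] by (intro finprod_cong') auto
    show "card ((\<lambda>b. restrict b ?D) ` B) \<le> card (trajectory G \<alpha> ?D X)"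
    proof (rule card_inj_on_le)
      show "inj_on (\<lambda>x. \<Otimes>g\<in>?D. x g) ((\<lambda>b. restrict b ?D) ` B)"
      proof (rule inj_onI, elim imageE)
        fix x y b b' assume *: "(\<Otimes>g\<in>?D. x g) = (\<Otimes>g\<in>?D. y g)"
          and b: "x = restrict b ?D" "b \<in> B" "y = restrict b' ?D" "b' \<in> B"
        have "(\<Otimes>g\<in>?D. b g) = (\<Otimes>g\<in>?D. b' g)"
          using * sum_restrict b by simp
        then have "b g = b' g" if "g \<in> ?D" for g
          using determined[of ?D b b' g] b that by blast
        then show "x = y" unfolding b(1,3) by (rule restrict_ext)
      qed
      show "(\<lambda>x. \<Otimes>g\<in>?D. x g) ` (\<lambda>b. restrict b ?D) ` B \<subseteq> trajectory G \<alpha> ?D X"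
      proof (clarify)
        fix b assume b: "b \<in> B"
        have "(\<Otimes>g\<in>?D. b g) \<in> trajectory G \<alpha> ?D X"
          using mem[OF BTup[OF b]] unfolding trajectory_def by blast
        then show "(\<Otimes>g\<in>?D. restrict b ?D g) \<in> trajectory G \<alpha> ?D X" using sum_restrict[OF b] by simp
      qed
      show "finite (trajectory G \<alpha> ?D X)" using F X Y by (intro finite_trajectory) auto
    qed
  qed simp
  finally show ?thesis .
qed

text \<open>\<open>X\<close> may lack the identity, so the smaller sumset need not lie in the larger
  one; multiplying by one fixed product \<open>z\<close> over \<open>F - D\<close> embeds
  it.\<close>

lemma (in comm_group) card_trajectory_mono:
  assumes F: "finite F" "D \<subseteq> F" and X: "finite X" "X \<noteq> {}"
    and Y: "\<And>g. g \<in> F \<Longrightarrow> \<alpha> g ` X \<subseteq> carrier G"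
  shows "card (trajectory G \<alpha> D X) \<le> card (trajectory G \<alpha> F X)"
proof -
  obtain a where a: "a \<in> X" using X by blast
  define z where "z = (\<Otimes>g\<in>F - D. \<alpha> g a)"
  have z: "z \<in> carrier G" unfolding z_def using Y a by (intro finprod_closed) blast
  show ?thesis
  proof (rule card_inj_on_le)
    have "trajectory G \<alpha> D X \<subseteq> carrier G" using Y F by (intro trajectory_subset) blast
    then show "inj_on (\<lambda>t. t \<otimes> z) (trajectory G \<alpha> D X)"
      using z by (intro inj_onI) (simp add: subset_iff)
    show "(\<lambda>t. t \<otimes> z) ` trajectory G \<alpha> D X \<subseteq> trajectory G \<alpha> F X"
    proof
      fix s assume "s \<in> (\<lambda>t. t \<otimes> z) ` trajectory G \<alpha> D X"
      then obtain x where x: "s = (\<Otimes>g\<in>D. x g) \<otimes> z" "\<And>g. g \<in> D \<Longrightarrow> x g \<in> \<alpha> g ` X"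
        by (auto simp: trajectory_def)
      define y where "y = (\<lambda>g. if g \<in> D then x g else \<alpha> g a)"
      have y: "y g \<in> \<alpha> g ` X" if "g \<in> F" for g using that x a by (simp add: y_def)
      then have yc: "y g \<in> carrier G" if "g \<in> F" for g using Y that by blast
      have "(\<Otimes>g\<in>D. y g) = (\<Otimes>g\<in>D. x g)"
        using x(2) Y F by (intro finprod_cong' funcsetI) (fastforce simp: y_def)+
      moreover have "(\<Otimes>g\<in>F - D. y g) = z"
        unfolding z_def using Y a by (intro finprod_cong' funcsetI) (auto simp: y_def)
      ultimately have "s = (\<Otimes>g\<in>F. y g)" using finprod_split[OF F yc] x(1) by simp
      then show "s \<in> trajectory G \<alpha> F X" using y unfolding trajectory_def by blast
    qed
    show "finite (trajectory G \<alpha> F X)" by (rule finite_trajectory[OF F(1) X(1) Y])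
  qed
qed

lemma (in comm_group) endo_finprod:
  assumes h: "h \<in> hom G G" and "finite K" "\<And>g. g \<in> K \<Longrightarrow> x g \<in> carrier G"
  shows "(\<Otimes>g\<in>K. h (x g)) = h (\<Otimes>g\<in>K. x g)"
  using assms(2,3)
proof (induction K rule: finite_induct)
  case empty
  show ?case using hom_one[OF h is_group is_group] by simp
next
  case (insert g K)
  have "(\<Otimes>g\<in>K. x g) \<in> carrier G" using insert.prems by (intro finprod_closed) blast
  moreover have "h y \<in> carrier G" if "y \<in> carrier G" for y using hom_in_carrier[OF h that] .
  ultimately show ?case
    using insert by (simp add: Pi_def hom_mult[OF h])
qed

text \<open>The endomorphism \<open>\<alpha> c\<close> factors out of every sum over the translate,
  so the new sumset lies in an image of the old one, and an image has no more elements.\<close>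

lemma card_trajectory_l_coset:
  assumes "group G" "comm_group A" and act: "endo_action G A \<alpha>"
    and X: "finite X" "X \<subseteq> carrier A" and K: "finite K" "K \<subseteq> carrier G" and c: "c \<in> carrier G"
  shows "card (trajectory A \<alpha> (c <#\<^bsub>G\<^esub> K) X) \<le> card (trajectory A \<alpha> K X)"
proof -
  interpret G: group G by fact
  interpret A: comm_group A by fact
  have hom: "\<alpha> g \<in> hom A A" if "g \<in> carrier G" for g using act that by (simp add: endo_action_def)
  have Y: "\<alpha> g ` X \<subseteq> carrier A" if "g \<in> carrier G" for g
    using hom_in_carrier[OF hom[OF that]] X by blast
  have "trajectory A \<alpha> (c <#\<^bsub>G\<^esub> K) X \<subseteq> \<alpha> c ` trajectory A \<alpha> K X"
  proof
    fix t assume "t \<in> trajectory A \<alpha> (c <#\<^bsub>G\<^esub> K) X"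
    then obtain x where x: "t = (\<Otimes>\<^bsub>A\<^esub>g\<in>c <#\<^bsub>G\<^esub> K. x g)" "\<And>g. g \<in> c <#\<^bsub>G\<^esub> K \<Longrightarrow> x g \<in> \<alpha> g ` X"
      by (auto simp: trajectory_def)
    have "\<exists>y\<in>X. x (c \<otimes>\<^bsub>G\<^esub> g) = \<alpha> c (\<alpha> g y)" if g: "g \<in> K" for g
    proof -
      have "c \<otimes>\<^bsub>G\<^esub> g \<in> c <#\<^bsub>G\<^esub> K" using g by (auto simp: l_coset_def)
      then obtain y where "y \<in> X" "x (c \<otimes>\<^bsub>G\<^esub> g) = \<alpha> (c \<otimes>\<^bsub>G\<^esub> g) y" using x(2) by blast
      moreover have "\<alpha> (c \<otimes>\<^bsub>G\<^esub> g) y = \<alpha> c (\<alpha> g y)"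
        using act c subsetD[OF K(2) g] subsetD[OF X(2) \<open>y \<in> X\<close>] by (simp add: endo_action_def)
      ultimately show ?thesis by auto
    qed
    then obtain y where y: "\<And>g. g \<in> K \<Longrightarrow> y g \<in> X" "\<And>g. g \<in> K \<Longrightarrow> x (c \<otimes>\<^bsub>G\<^esub> g) = \<alpha> c (\<alpha> g (y g))"
      by metis
    have yc: "\<alpha> g (y g) \<in> carrier A" if "g \<in> K" for g using Y y(1) K that by blast
    have coset: "c <#\<^bsub>G\<^esub> K = (\<lambda>g. c \<otimes>\<^bsub>G\<^esub> g) ` K" by (auto simp: l_coset_def)
    have "t = (\<Otimes>\<^bsub>A\<^esub>g\<in>K. x (c \<otimes>\<^bsub>G\<^esub> g))"
      unfolding x(1) coset
    proof (rule A.finprod_reindex)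
      show "x \<in> (\<lambda>g. c \<otimes>\<^bsub>G\<^esub> g) ` K \<rightarrow> carrier A"
        using y(2) hom_in_carrier[OF hom[OF c]] yc by auto
      show "inj_on (\<lambda>g. c \<otimes>\<^bsub>G\<^esub> g) K" using c K by (intro inj_onI) (simp add: subset_iff)
    qed
    also have "\<dots> = (\<Otimes>\<^bsub>A\<^esub>g\<in>K. \<alpha> c (\<alpha> g (y g)))"
      using y(2) hom_in_carrier[OF hom[OF c]] yc by (intro A.finprod_cong') auto
    also have "\<dots> = \<alpha> c (\<Otimes>\<^bsub>A\<^esub>g\<in>K. \<alpha> g (y g))"
      using yc by (intro A.endo_finprod hom c K)
    finally show "t \<in> \<alpha> c ` trajectory A \<alpha> K X" using y(1) by (auto simp: trajectory_def)
  qed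
  moreover have "finite (trajectory A \<alpha> K X)" using Y K X by (intro A.finite_trajectory) auto
  ultimately show ?thesis by (meson card_image_le card_mono finite_imageI order_trans)
qed

section \<open>The entropy as an infimum\<close>

lemma card_trajectory_pos:
  assumes "group G" "comm_group A" and act: "endo_action G A \<alpha>"
    and X: "finite X" "X \<subseteq> carrier A" "X \<noteq> {}" and K: "finite K" "K \<subseteq> carrier G"
  shows "card (trajectory A \<alpha> K X) > 0"
proof -
  interpret A: comm_group A by fact
  have "\<alpha> g ` X \<subseteq> carrier A" if "g \<in> carrier G" for g
    using act that X(2) by (auto simp: endo_action_def intro: hom_in_carrier)
  then have Y: "\<alpha> g ` X \<subseteq> carrier A" if "g \<in> K" for g using K that by blast
  have "trajectory A \<alpha> K X \<noteq> {}"
    using X(3) by (subst A.trajectory_eq_image[OF Y]) (auto simp: PiE_eq_empty_iff)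
  moreover have "finite (trajectory A \<alpha> K X)" by (rule A.finite_trajectory[OF K(1) X(1) Y])
  ultimately show ?thesis by (simp add: card_gt_0_iff)
qed

text \<open>Each point of \<open>F\<close> lies in exactly \<open>|K|\<close> of the translates \<open>c K\<close> with \<open>c\<close> in \<open>F K\<^sup>-\<^sup>1\<close>.\<close>

lemma trajectory_rate_le:
  assumes "group G" "comm_group A" and act: "endo_action G A \<alpha>"
    and X: "finite X" "X \<subseteq> carrier A" "X \<noteq> {}"
    and F: "finite F" "F \<noteq> {}" "F \<subseteq> carrier G" and K: "finite K" "K \<noteq> {}" "K \<subseteq> carrier G"
  shows "ln (real (card (trajectory A \<alpha> F X))) / real (card F) \<le>
    (1 + (\<Sum>k\<in>K. real (card ((F #>\<^bsub>G\<^esub> inv\<^bsub>G\<^esub> k) - F)) / real (card F))) *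
    (ln (real (card (trajectory A \<alpha> K X))) / real (card K))"
proof -
  interpret G: group G by fact
  interpret A: comm_group A by fact
  let ?T = "\<lambda>F. card (trajectory A \<alpha> F X)"
  define C where "C = (\<Union>k\<in>K. F #>\<^bsub>G\<^esub> inv\<^bsub>G\<^esub> k)"
  have fin_coset: "finite (F #>\<^bsub>G\<^esub> g)" for g using F by (simp add: r_coset_def)
  have C: "finite C" "C \<subseteq> carrier G"
    using fin_coset K G.r_coset_subset_G[OF F(3)] unfolding C_def by blast+
  have Y: "\<alpha> g ` X \<subseteq> carrier A" if "g \<in> carrier G" for g
    using act that X(2) by (auto simp: endo_action_def intro: hom_in_carrier)
  have k0: "card K > 0" "card F > 0" using F K by (auto simp: card_gt_0_iff)
  \<comment> \<open>\<open>g\<close> lies in the translate of \<open>K\<close> by \<open>c\<close>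
    exactly when \<open>c\<close> is g k^-1 for some \<open>k\<close> in \<open>K\<close>; all these
    lie in \<open>C\<close>, and distinct \<open>k\<close> give distinct \<open>c\<close>.\<close>
  have cover: "card {c \<in> C. g \<in> c <#\<^bsub>G\<^esub> K} = card K" if g: "g \<in> F" for g
  proof -
    have gG: "g \<in> carrier G" using F g by blast
    have "{c \<in> C. g \<in> c <#\<^bsub>G\<^esub> K} = (\<lambda>k. g \<otimes>\<^bsub>G\<^esub> inv\<^bsub>G\<^esub> k) ` K"
    proof (intro subset_antisym subsetI)
      fix c assume "c \<in> {c \<in> C. g \<in> c <#\<^bsub>G\<^esub> K}"
      then obtain k where k: "c \<in> carrier G" "k \<in> K" "g = c \<otimes>\<^bsub>G\<^esub> k"
        using C by (auto simp: l_coset_def)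
      then have "c = g \<otimes>\<^bsub>G\<^esub> inv\<^bsub>G\<^esub> k" using K gG by (simp add: G.inv_solve_right subset_iff)
      then show "c \<in> (\<lambda>k. g \<otimes>\<^bsub>G\<^esub> inv\<^bsub>G\<^esub> k) ` K" using k by blast
    next
      fix c assume "c \<in> (\<lambda>k. g \<otimes>\<^bsub>G\<^esub> inv\<^bsub>G\<^esub> k) ` K"
      then obtain k where k: "k \<in> K" "c = g \<otimes>\<^bsub>G\<^esub> inv\<^bsub>G\<^esub> k" by blast
      then have "k \<in> carrier G" using K by blast
      then have "g = c \<otimes>\<^bsub>G\<^esub> k" using k gG by (simp add: G.m_assoc)
      then have "g \<in> c <#\<^bsub>G\<^esub> K" using k by (auto simp: l_coset_def)
      moreover have "c \<in> C" using k g by (auto simp: C_def r_coset_def)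
      ultimately show "c \<in> {c \<in> C. g \<in> c <#\<^bsub>G\<^esub> K}" by blast
    qed
    moreover have "inj_on (\<lambda>k. g \<otimes>\<^bsub>G\<^esub> inv\<^bsub>G\<^esub> k) K"
    proof (rule inj_onI)
      fix k l assume "k \<in> K" "l \<in> K" "g \<otimes>\<^bsub>G\<^esub> inv\<^bsub>G\<^esub> k = g \<otimes>\<^bsub>G\<^esub> inv\<^bsub>G\<^esub> l"
      moreover from this have "k \<in> carrier G" "l \<in> carrier G" using K by auto
      ultimately have "inv\<^bsub>G\<^esub> k = inv\<^bsub>G\<^esub> l" using gG by simp
      then show "k = l" using inj_onD[OF G.inv_inj] \<open>k \<in> carrier G\<close> \<open>l \<in> carrier G\<close> by blast
    qed
    ultimately show ?thesis by (simp add: card_image)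
  qed
  have "?T F ^ card K \<le> (\<Prod>c\<in>C. ?T (F \<inter> (c <#\<^bsub>G\<^esub> K)))"
    using F Y by (intro A.Shearer_trajectory X(1) C(1) k0(1) cover) auto
  also have "\<dots> \<le> (\<Prod>c\<in>C. ?T K)"
  proof (intro prod_mono conjI)
    fix c assume "c \<in> C"
    then have c: "c \<in> carrier G" using C by blast
    have cK: "finite (c <#\<^bsub>G\<^esub> K)" "c <#\<^bsub>G\<^esub> K \<subseteq> carrier G"
      using K G.l_coset_subset_G[OF K(3) c] by (simp_all add: l_coset_def)
    have "?T (F \<inter> (c <#\<^bsub>G\<^esub> K)) \<le> ?T (c <#\<^bsub>G\<^esub> K)"
      using cK Y by (intro A.card_trajectory_mono X(1,3)) auto
    also have "\<dots> \<le> ?T K"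
      by (rule card_trajectory_l_coset[OF assms(1,2) act X(1,2) K(1,3) c])
    finally show "?T (F \<inter> (c <#\<^bsub>G\<^esub> K)) \<le> ?T K" .
  qed simp
  finally have "?T F ^ card K \<le> ?T K ^ card C" by simp
  moreover have T0: "?T F > 0" "?T K > 0"
    by (rule card_trajectory_pos[OF assms(1,2) act X]; use F K in blast)+
  ultimately have "ln (real (?T F) ^ card K) \<le> ln (real (?T K) ^ card C)"
    by (subst ln_le_cancel_iff) (auto simp flip: of_nat_power)
  then have main: "real (card K) * ln (real (?T F)) \<le> real (card C) * ln (real (?T K))"
    using T0 by (simp add: ln_realpow)
  \<comment> \<open>What \<open>C\<close> adds to \<open>F\<close> is covered by the boundaries of
    \<open>F\<close> under the elements k^-1, finitely many quantities of the kind that the Folner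
    condition sends to 0 relative to \<open>card F\<close>.\<close>
  have "C \<subseteq> F \<union> (\<Union>k\<in>K. (F #>\<^bsub>G\<^esub> inv\<^bsub>G\<^esub> k) - F)" by (auto simp: C_def)
  then have "card C \<le> card (F \<union> (\<Union>k\<in>K. (F #>\<^bsub>G\<^esub> inv\<^bsub>G\<^esub> k) - F))"
    using F K fin_coset by (intro card_mono) auto
  also have "\<dots> \<le> card F + card (\<Union>k\<in>K. (F #>\<^bsub>G\<^esub> inv\<^bsub>G\<^esub> k) - F)" by (rule card_Un_le)
  also have "\<dots> \<le> card F + (\<Sum>k\<in>K. card ((F #>\<^bsub>G\<^esub> inv\<^bsub>G\<^esub> k) - F))"
    by (rule add_left_mono[OF card_UN_le[OF K(1)]])
  finally have "real (card C) \<le> real (card F + (\<Sum>k\<in>K. card ((F #>\<^bsub>G\<^esub> inv\<^bsub>G\<^esub> k) - F)))"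
    by (rule of_nat_mono)
  then have "real (card C) / real (card F) \<le>
      (real (card F) + (\<Sum>k\<in>K. real (card ((F #>\<^bsub>G\<^esub> inv\<^bsub>G\<^esub> k) - F)))) / real (card F)"
    by (intro divide_right_mono) auto
  also have "\<dots> = 1 + (\<Sum>k\<in>K. real (card ((F #>\<^bsub>G\<^esub> inv\<^bsub>G\<^esub> k) - F)) / real (card F))"
    using k0 by (simp add: add_divide_distrib sum_divide_distrib)
  finally have ratio: "real (card C) / real (card F) \<le>
      1 + (\<Sum>k\<in>K. real (card ((F #>\<^bsub>G\<^esub> inv\<^bsub>G\<^esub> k) - F)) / real (card F))" .
  have "ln (real (?T F)) / real (card F) \<le>
      (real (card C) / real (card F)) * (ln (real (?T K)) / real (card K))"
    using main k0 by (simp add: divide_simps mult.commute)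
  also have "\<dots> \<le> (1 + (\<Sum>k\<in>K. real (card ((F #>\<^bsub>G\<^esub> inv\<^bsub>G\<^esub> k) - F)) / real (card F))) *
      (ln (real (?T K)) / real (card K))"
    using T0 by (intro mult_right_mono ratio) auto
  finally show ?thesis .
qed

text \<open>Each member of a net competes in the infimum, so no value along it lies below.
  Conversely, a near-optimal \<open>K\<close> bounds the values from above up to a factor tending to
  1.\<close>

lemma H_alg_eq_INF:
  fixes G :: "('g, 'm) monoid_scheme"
  assumes "group G" "amenable G" "comm_group A" and act: "endo_action G A \<alpha>"
    and X: "finite X" "X \<subseteq> carrier A" "X \<noteq> {}"
  shows "H_alg G A \<alpha> X = (INF K\<in>{K. finite K \<and> K \<noteq> {} \<and> K \<subseteq> carrier G}.
    ln (real (card (trajectory A \<alpha> K X))) / real (card K))"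
proof -
  interpret G: group G by fact
  define u where "u = (\<lambda>K. ln (real (card (trajectory A \<alpha> K X))) / real (card K))"
  define \<K> where "\<K> = {K. finite K \<and> K \<noteq> {} \<and> K \<subseteq> carrier G}"
  have \<K>: "\<K> \<noteq> {}" unfolding \<K>_def using G.one_closed by blast
  have ln0: "0 \<le> ln (real n)" for n :: nat by (cases "n = 0") auto
  have bdd: "bdd_below (u ` \<K>)" unfolding bdd_below_def u_def using ln0 by (intro exI[of _ 0]) auto
  have lim: "((\<lambda>i. u (F i)) \<longlongrightarrow> (INF K\<in>\<K>. u K)) (net_filter I r)"
    if net: "right_folner_net G I r F" for I :: "('g set \<times> nat) set" and r F
  proof -
    have dI: "directed_index I r" and FK: "\<And>i. i \<in> I \<Longrightarrow> F i \<in> \<K>"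
      using net by (auto simp: right_folner_net_def \<K>_def)
    have ev: "\<forall>\<^sub>F i in net_filter I r. Q i" if "\<And>i. i \<in> I \<Longrightarrow> Q i" for Q
      unfolding eventually_net_filter[OF dI] using dI that by (auto simp: directed_index_def)
    show ?thesis
    proof (rule order_tendstoI)
      fix c assume "c < (INF K\<in>\<K>. u K)"
      then show "\<forall>\<^sub>F i in net_filter I r. c < u (F i)"
        by (intro ev) (rule less_le_trans[OF _ cINF_lower[OF bdd FK]])
    next
      fix c assume "(INF K\<in>\<K>. u K) < c"
      then obtain K where K: "K \<in> \<K>" "u K < c" using cINF_less_iff[OF \<K> bdd] by blast
      let ?q = "\<lambda>i k. real (card ((F i #>\<^bsub>G\<^esub> inv\<^bsub>G\<^esub> k) - F i)) / real (card (F i))"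
      have "((\<lambda>i. ?q i k) \<longlongrightarrow> 0) (net_filter I r)" if "k \<in> K" for k
        using net K that by (auto simp: right_folner_net_def \<K>_def)
      then have "((\<lambda>i. (1 + (\<Sum>k\<in>K. ?q i k)) * u K) \<longlongrightarrow> (1 + (\<Sum>k\<in>K. 0)) * u K) (net_filter I r)"
        by (intro tendsto_intros)
      then have "\<forall>\<^sub>F i in net_filter I r. (1 + (\<Sum>k\<in>K. ?q i k)) * u K < c"
        using K by (intro order_tendstoD(2)) auto
      moreover have "\<forall>\<^sub>F i in net_filter I r. u (F i) \<le> (1 + (\<Sum>k\<in>K. ?q i k)) * u K"
        unfolding u_def using FK K
        by (intro ev trajectory_rate_le[OF assms(1,3) act X]) (auto simp: \<K>_def)
      ultimately show "\<forall>\<^sub>F i in net_filter I r. u (F i) < c"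
        by eventually_elim simp
    qed
  qed
  \<comment> \<open>One actual net with a proper filter is what makes the limit under
    \<open>THE\<close> unique.\<close>
  obtain I :: "('g set \<times> nat) set" and r F where net: "right_folner_net G I r F"
    using G.ex_right_folner_net[OF assms(2)] by blast
  then have nontriv: "net_filter I r \<noteq> bot" by (intro net_filter_neq_bot) (simp add: right_folner_net_def)
  have "H_alg G A \<alpha> X = (THE L. \<forall>(I :: ('g set \<times> nat) set) r F. right_folner_net G I r F \<longrightarrow>
      ((\<lambda>i. u (F i)) \<longlongrightarrow> L) (net_filter I r))"
    by (simp only: H_alg_def u_def)
  also have "\<dots> = (INF K\<in>\<K>. u K)"
  proof (rule the_equality)
    fix L assume *: "\<forall>(I :: ('g set \<times> nat) set) r F. right_folner_net G I r F \<longrightarrow>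
        ((\<lambda>i. u (F i)) \<longlongrightarrow> L) (net_filter I r)"
    show "L = (INF K\<in>\<K>. u K)"
      by (rule tendsto_unique[OF nontriv *[rule_format, OF net] lim[OF net]])
  qed (intro allI impI lim)
  finally show ?thesis by (simp only: u_def \<K>_def)
qed

section \<open>Comparison with the restricted action\<close>

lemma H_alg_le_subgroup:
  fixes G :: "('g, 'm) monoid_scheme"
  assumes "group G" "amenable G" "comm_group A" and act: "endo_action G A \<alpha>"
    and N: "subgroup N G" and X: "finite X" "X \<subseteq> carrier A" "X \<noteq> {}"
  shows "H_alg G A \<alpha> X \<le> H_alg (G\<lparr>carrier := N\<rparr>) A \<alpha> X"
proof -
  interpret G: group G by fact
  interpret N: subgroup N G by fact
  let ?u = "\<lambda>K. ln (real (card (trajectory A \<alpha> K X))) / real (card K)"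
  have actN: "endo_action (G\<lparr>carrier := N\<rparr>) A \<alpha>"
    using act unfolding endo_action_def by (intro conjI ballI) (simp_all add: N.mem_carrier)
  have carN: "carrier (G\<lparr>carrier := N\<rparr>) = N" by simp
  have ln0: "0 \<le> ln (real n)" for n :: nat by (cases "n = 0") auto
  have "(INF K\<in>{K. finite K \<and> K \<noteq> {} \<and> K \<subseteq> carrier G}. ?u K) \<le>
      (INF K\<in>{K. finite K \<and> K \<noteq> {} \<and> K \<subseteq> N}. ?u K)"
  proof (rule cINF_greatest)
    have "{\<one>\<^bsub>G\<^esub>} \<in> {K. finite K \<and> K \<noteq> {} \<and> K \<subseteq> N}" by simp
    then show "{K. finite K \<and> K \<noteq> {} \<and> K \<subseteq> N} \<noteq> {}" by (metis empty_iff)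
    fix K assume "K \<in> {K. finite K \<and> K \<noteq> {} \<and> K \<subseteq> N}"
    then have "K \<in> {K. finite K \<and> K \<noteq> {} \<and> K \<subseteq> carrier G}" using N.subset by auto
    moreover have "bdd_below (?u ` {K. finite K \<and> K \<noteq> {} \<and> K \<subseteq> carrier G})"
      by (rule bdd_belowI2[of _ 0]) (simp add: ln0)
    ultimately show "(INF K\<in>{K. finite K \<and> K \<noteq> {} \<and> K \<subseteq> carrier G}. ?u K) \<le> ?u K"
      by (intro cINF_lower)
  qed
  moreover have "H_alg G A \<alpha> X = (INF K\<in>{K. finite K \<and> K \<noteq> {} \<and> K \<subseteq> carrier G}. ?u K)"
    by (rule H_alg_eq_INF[OF assms(1-3) act X])
  moreover have "H_alg (G\<lparr>carrier := N\<rparr>) A \<alpha> X = (INF K\<in>{K. finite K \<and> K \<noteq> {} \<and> K \<subseteq> N}. ?u K)"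
    using H_alg_eq_INF[OF N.subgroup_is_group[OF assms(1)] G.amenable_subgroup[OF assms(2) N]
        assms(3) actN X] by (simp only: carN)
  ultimately show ?thesis by (simp only:)
qed

theorem proposition5p8:
  fixes G :: "('g, 'm) monoid_scheme" and A :: "('a, 'n) monoid_scheme"
    and \<alpha> :: "'g \<Rightarrow> 'a \<Rightarrow> 'a" and N :: "'g set"
  assumes "group G" and "amenable G"
    and "comm_group A"
    and "endo_action G A \<alpha>"
    and "normal N G"
  shows "h_alg G A \<alpha> \<le> h_alg (G\<lparr>carrier := N\<rparr>) A \<alpha> \<and> ent G A \<alpha> \<le> ent (G\<lparr>carrier := N\<rparr>) A \<alpha>"
proof
  \<comment> \<open>\<open>A\<close> is the same for both actions, so the suprema run over the same
    sets and each \<open>X\<close> is compared with itself.\<close>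
  have le: "ereal (H_alg G A \<alpha> X) \<le> ereal (H_alg (G\<lparr>carrier := N\<rparr>) A \<alpha> X)"
    if "finite X" "X \<subseteq> carrier A" "X \<noteq> {}" for X
    using H_alg_le_subgroup[OF assms(1-4) normal_imp_subgroup[OF assms(5)] that] by simp
  show "h_alg G A \<alpha> \<le> h_alg (G\<lparr>carrier := N\<rparr>) A \<alpha>"
    unfolding h_alg_def by (rule SUP_mono) (use le in blast)
  show "ent G A \<alpha> \<le> ent (G\<lparr>carrier := N\<rparr>) A \<alpha>"
    unfolding ent_def
  proof (rule SUP_mono)
    fix X assume "X \<in> {X. subgroup X A \<and> finite X}"
    moreover from this have "X \<subseteq> carrier A" "X \<noteq> {}"
      using subgroup.subset subgroup.one_closed by blast+
    ultimately show "\<exists>Z\<in>{X. subgroup X A \<and> finite X}.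
        ereal (H_alg G A \<alpha> X) \<le> ereal (H_alg (G\<lparr>carrier := N\<rparr>) A \<alpha> Z)"
      using le by blast
  qed
qed

end
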